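(* Suppose that the last two columns of $v^{\|}\in\mathbf{A}^{r\times n}$ are nonzero and equal, and that $v\in\mathbf{A}^{r\times n}$ is obtained from $v^{\|}$ by changing the last column to zero. Then $$\mathcal{K}(X_{v^{\|}})=\delta_{n-1}\,\mathcal{K}(X_v),$$ where $\delta_{n-1}(f)=\dfrac{t_{n-1}f-t_n\,\sigma_{n-1}f}{t_{n-1}-t_n}$ for $f\in\mathbb{Z}[t_1,\dots,t_n,u_1,\dots,u_r]$.
   Context: $\mathbf{k}$ is an algebraically closed field of characteristic zero. For $v\in\mathbf{A}^{r\times n}$ (the space of $r$-by-$n$ matrices), $X_v$ is the Zariski closure of the orbit of $v$ under $\mathrm{GL}_r(\mathbf{k})\times(\mathbf{k}^\times)^n$, acting by left multiplication and rescaling of columns. The coordinate ring $R=\mathbf{k}[x_{ij}]$ of $\mathbf{A}^{r\times n}$ is graded by $\mathbb{Z}^r\times\mathbb{Z}^n$ with $\deg x_{ij}=a_i+b_j$ (standard basis vectors). For a closed subvariety $X$ with ideal $I$, the $K$-polynomial $\mathcal{K}(X)$ is the polynomial with $\sum\dim_{\mathbf{k}}((R/I)_{(\mathbf{a},\mathbf{b})})u^{\mathbf{a}}t^{\mathbf{b}}=\mathcal{K}(X)/\prod_{i=1}^r\prod_{j=1}^n(1-u_it_j)$. $\sigma_{n-1}$ acts by exchanging the variables $t_{n-1}$ and $t_n$. *)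

theory Defs
  imports
    "HOL-Library.Poly_Mapping"
    "HOL-Combinatorics.Transposition"
    "HOL-Computational_Algebra.Polynomial"
    "Jordan_Normal_Form.Matrix"
begin

text \<open>
  Rows and columns are numbered from 0, so the last two columns of an \<open>r \<times> n\<close> matrix
  have the indices \<open>n - 2\<close> and \<open>n - 1\<close>.

  A polynomial with variables in \<open>'x\<close> and coefficients in \<open>'b\<close> is an element of
  \<open>('x \<Rightarrow>\<^sub>0 nat) \<Rightarrow>\<^sub>0 'b\<close>; the ring operations are those of
  \<^theory>\<open>HOL-Library.Poly_Mapping\<close>.  The pair \<open>(i, j)\<close> stands for the variable \<open>x\<^sub>i\<^sub>j\<close>.
\<close>

type_synonym ('x, 'b) mpolynomial = "('x \<Rightarrow>\<^sub>0 nat) \<Rightarrow>\<^sub>0 'b"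
type_synonym 'a mat_poly = "(nat \<times> nat, 'a) mpolynomial"

definition const :: "'b::zero \<Rightarrow> ('x, 'b) mpolynomial" where
  "const c = Poly_Mapping.single 0 c"

definition var :: "'x \<Rightarrow> ('x, 'b::zero_neq_one) mpolynomial" where
  "var x = Poly_Mapping.single (Poly_Mapping.single x 1) 1"

definition coordinate_ring :: "nat \<Rightarrow> nat \<Rightarrow> ('a::comm_ring_1) mat_poly set" where
  "coordinate_ring r n =
     {p. \<forall>m \<in> Poly_Mapping.keys p. Poly_Mapping.keys m \<subseteq> {..<r} \<times> {..<n}}"

definition eval_at :: "('a::comm_ring_1) mat \<Rightarrow> 'a mat_poly \<Rightarrow> 'a" where
  "eval_at A p = (\<Sum>m \<in> Poly_Mapping.keys p. Poly_Mapping.lookup p m *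
     (\<Prod>x \<in> Poly_Mapping.keys m. (A $$ x) ^ Poly_Mapping.lookup m x))"


subsection \<open>Orbit closures\<close>

definition zariski_closed :: "nat \<Rightarrow> nat \<Rightarrow> ('a::field) mat set \<Rightarrow> bool" where
  "zariski_closed r n X \<longleftrightarrow>
     (\<exists>P \<subseteq> coordinate_ring r n. X = {A \<in> carrier_mat r n. \<forall>p\<in>P. eval_at A p = 0})"

definition matrix_orbit :: "nat \<Rightarrow> nat \<Rightarrow> ('a::field) mat \<Rightarrow> 'a mat set" where
  "matrix_orbit r n v =
     {g * v * mat_diag n s | g s. g \<in> carrier_mat r r \<and> invertible_mat g \<and> (\<forall>j<n. s j \<noteq> 0)}"

definition orbit_closure :: "nat \<Rightarrow> nat \<Rightarrow> ('a::field) mat \<Rightarrow> 'a mat set" where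
  "orbit_closure r n v = zariski_closed r n hull matrix_orbit r n v"

definition vanishing_ideal :: "nat \<Rightarrow> nat \<Rightarrow> ('a::field) mat set \<Rightarrow> 'a mat_poly set" where
  "vanishing_ideal r n X = {p \<in> coordinate_ring r n. \<forall>A\<in>X. eval_at A p = 0}"


subsection \<open>Multigraded Hilbert functions and \<open>K\<close>-polynomials\<close>

text \<open>
  \<open>U i\<close> and \<open>T j\<close> index both the standard basis vectors \<open>a\<^sub>i\<close>, \<open>b\<^sub>j\<close> of the grading group
  and the variables \<open>u\<^sub>i\<close>, \<open>t\<^sub>j\<close>.  Graded pieces in degrees with a negative coordinate vanish,
  so degrees are represented by finitely supported functions into \<^typ>\<open>nat\<close>; pieces in degrees
  that involve an index outside \<open>i < r\<close>, \<open>j < n\<close> vanish as well.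
\<close>

datatype gvar = U nat | T nat

type_synonym degree = "gvar \<Rightarrow>\<^sub>0 nat"
type_synonym ut_poly = "(gvar, int) mpolynomial"

definition multidegree :: "(nat \<times> nat \<Rightarrow>\<^sub>0 nat) \<Rightarrow> degree" where
  "multidegree m = (\<Sum>(i, j) \<in> Poly_Mapping.keys m.
     Poly_Mapping.single (U i) (Poly_Mapping.lookup m (i, j)) +
     Poly_Mapping.single (T j) (Poly_Mapping.lookup m (i, j)))"

definition graded_piece :: "nat \<Rightarrow> nat \<Rightarrow> degree \<Rightarrow> ('a::field) mat_poly set" where
  "graded_piece r n d =
     {p \<in> coordinate_ring r n. \<forall>m \<in> Poly_Mapping.keys p. multidegree m = d}"

text \<open>
  \<open>is_basis_mod V I B\<close>: the cosets \<open>b + I\<close> for \<open>b \<in> B\<close> are pairwise distinct and form a basis of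
  the image \<open>(V + I) / I\<close> of the vector space \<open>V\<close> in the quotient by \<open>I\<close>.
\<close>

definition is_basis_mod ::
    "('a::field) mat_poly set \<Rightarrow> 'a mat_poly set \<Rightarrow> 'a mat_poly set \<Rightarrow> bool" where
  "is_basis_mod V I B \<longleftrightarrow> finite B \<and> B \<subseteq> V \<and>
     (\<forall>p\<in>V. \<exists>c. p - (\<Sum>b\<in>B. const (c b) * b) \<in> I) \<and>
     (\<forall>c. (\<Sum>b\<in>B. const (c b) * b) \<in> I \<longrightarrow> (\<forall>b\<in>B. c b = 0))"

definition quotient_dim :: "('a::field) mat_poly set \<Rightarrow> 'a mat_poly set \<Rightarrow> nat" where
  "quotient_dim V I = (THE k. \<exists>B. is_basis_mod V I B \<and> card B = k)"

definition hilbert_function :: "nat \<Rightarrow> nat \<Rightarrow> ('a::field) mat set \<Rightarrow> degree \<Rightarrow> nat" where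
  "hilbert_function r n X d = quotient_dim (graded_piece r n d) (vanishing_ideal r n X)"

text \<open>
  A power series in the \<open>u\<^sub>i\<close>, \<open>t\<^sub>j\<close> is given by its coefficient function;
  \<open>poly_times_series P H\<close> is the Cauchy product of a polynomial with a power series.
\<close>

definition poly_times_series :: "ut_poly \<Rightarrow> (degree \<Rightarrow> int) \<Rightarrow> degree \<Rightarrow> int" where
  "poly_times_series P H d =
     (\<Sum>(m, e) | m \<in> Poly_Mapping.keys P \<and> m + e = d. Poly_Mapping.lookup P m * H e)"

definition K_denominator :: "nat \<Rightarrow> nat \<Rightarrow> ut_poly" where
  "K_denominator r n = (\<Prod>i<r. \<Prod>j<n. 1 - var (U i) * var (T j))"

text \<open>
  The denominator is invertible as a power series, so the defining equation of the
  \<open>K\<close>-polynomial may be multiplied by it.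
\<close>

definition K_polynomial :: "nat \<Rightarrow> nat \<Rightarrow> ('a::field) mat set \<Rightarrow> ut_poly" where
  "K_polynomial r n X = (THE K. \<forall>d. Poly_Mapping.lookup K d =
     poly_times_series (K_denominator r n) (\<lambda>e. int (hilbert_function r n X e)) d)"


subsection \<open>Divided difference operators\<close>

definition swap_T :: "nat \<Rightarrow> ut_poly \<Rightarrow> ut_poly" where
  "swap_T j f = Poly_Mapping.map_key (Poly_Mapping.map_key (transpose (T j) (T (Suc j)))) f"

text \<open>
  The quotient by \<open>t\<^sub>j - t\<^sub>j\<^sub>+\<^sub>1\<close> is exact, and unique because the polynomial ring is a domain.
\<close>

definition delta :: "nat \<Rightarrow> ut_poly \<Rightarrow> ut_poly" where
  "delta j f = (THE g. (var (T j) - var (T (Suc j))) * g =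
     var (T j) * f - var (T (Suc j)) * swap_T j f)"

end

theory Submission
  imports Defs "HOL-Library.Product_Lexorder"
begin

text \<open>
  Let \<open>w\<close> be the matrix with two equal last columns and \<open>v\<close> the one whose last column is zero;
  write \<open>t\<close> and \<open>s\<close> for the last two column variables.

  The theorem is a comparison of Hilbert functions.  A point \<open>g w diag(z)\<close> of the orbit of \<open>w\<close>
  agrees with the point \<open>g v diag(z)\<close> of the orbit of \<open>v\<close> except that its last column is a nonzero
  multiple of the column before it.  Hence a form \<open>f\<close> of degree \<open>(\<dots>, p, q)\<close> in the last two
  columns takes at the first point, up to a nonzero factor, the value that its image \<open>f'\<close> under the
  substitution of the last-but-one column for the last one takes at the second
  (\<open>eval_at_merge\<close>).  The substitution maps the forms of degree \<open>(\<dots>, p, q)\<close> onto those of degree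
  \<open>(\<dots>, p + q, 0)\<close>, and \<open>f\<close> vanishes on the orbit of \<open>w\<close> if and only if \<open>f'\<close> vanishes on the orbit
  of \<open>v\<close>.  So the two Hilbert functions satisfy \<open>H\<^sub>w(\<dots>, p, q) = H\<^sub>v(\<dots>, p + q, 0)\<close>
  (\<open>hilbert_function_parallel\<close>), while \<open>H\<^sub>v(\<dots>, p, q) = 0\<close> for \<open>q > 0\<close>
  (\<open>hilbert_function_last_zero\<close>).  Since \<open>(t - s) \<cdot> (\<Sum> t\<^sup>p s\<^sup>q) = t \<cdot> t\<^sup>m - s \<cdot> s\<^sup>m\<close>, where the sum
  runs over \<open>p + q = m\<close>, this says \<open>(t - s) H\<^sub>w = t H\<^sub>v - s \<sigma>(H\<^sub>v)\<close> for the Hilbert series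
  (\<open>hilbert_series_divided_difference\<close>).  The common denominator \<open>\<Prod>(1 - u\<^sub>i t\<^sub>j)\<close> is symmetric in
  \<open>t\<close> and \<open>s\<close>, so the same equation holds for the \<open>K\<close>-polynomials, and \<open>t - s\<close> is a nonzerodivisor on
  power series.

  The other half of the work is that \<open>K\<close>-polynomials exist, that is, that the denominator times
  a Hilbert series is a polynomial (\<open>K_polynomial_exists\<close>).  For this the quotient by a vanishing
  ideal is replaced by the monomials that are not leading monomials of homogeneous elements of the
  ideal: they form a basis in every degree (\<open>standard_monomials_basis\<close>).  The leading monomials
  are closed under multiplication by monomials, so by Dickson's lemma they are generated by a finite
  set, and the generating function of the remaining monomials is handled by induction on the
  number of generators (\<open>denominator_times_standard_monomials\<close>).
\<close>

section \<open>Polynomials as finitely supported functions\<close>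

lemma poly_mapping_sum_single:
  "p = (\<Sum>x\<in>Poly_Mapping.keys p. Poly_Mapping.single x (Poly_Mapping.lookup p x))"
proof (rule poly_mapping_eqI)
  fix k
  show "Poly_Mapping.lookup p k = Poly_Mapping.lookup (\<Sum>x\<in>Poly_Mapping.keys p.
      Poly_Mapping.single x (Poly_Mapping.lookup p x)) k"
    by (auto simp: lookup_sum lookup_single when_def in_keys_iff)
qed

text \<open>
  Facts that are additive in a polynomial, or in an exponent vector, need to be checked only on
  single terms.
\<close>

lemma poly_mapping_additive_induct [case_names zero single add]:
  fixes p :: "'k \<Rightarrow>\<^sub>0 'b::comm_monoid_add"
  assumes "P 0" "\<And>x c. P (Poly_Mapping.single x c)" "\<And>p q. P p \<Longrightarrow> P q \<Longrightarrow> P (p + q)"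
  shows "P p"
proof -
  have "P (\<Sum>x\<in>A. Poly_Mapping.single x (Poly_Mapping.lookup p x))" if "finite A" for A
    using that by (induction A rule: finite_induct) (auto intro: assms)
  from this[OF finite_keys] show ?thesis using poly_mapping_sum_single[of p] by metis
qed

lemma lookup_single_mult:
  fixes p :: "'k::cancel_comm_monoid_add \<Rightarrow>\<^sub>0 'b::comm_semiring_0"
  shows "Poly_Mapping.lookup (Poly_Mapping.single m c * p) d =
    (if \<exists>e. d = m + e then c * Poly_Mapping.lookup p (d - m) else 0)"
proof (induction p rule: poly_mapping_additive_induct)
  case zero
  then show ?case by simp
next
  case (single x c')
  have "m + x = d \<longleftrightarrow> x = d - m \<and> (\<exists>e. d = m + e)" by auto
  then show ?case by (simp add: mult_single lookup_single when_def)
next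
  case (add p q)
  then show ?case by (auto simp: distrib_left lookup_add)
qed

lemma lookup_const_mult:
  fixes p :: "('x, 'b::comm_semiring_0) mpolynomial"
  shows "Poly_Mapping.lookup (const c * p) m = c * Poly_Mapping.lookup p m"
  by (simp add: const_def lookup_single_mult)

lemma const_add: "const (a + b) = (const a + const b :: ('x, 'b::comm_ring_1) mpolynomial)"
  by (simp add: const_def single_add)

lemma const_mult: "const (a * b) = (const a * const b :: ('x, 'b::comm_ring_1) mpolynomial)"
  by (simp add: const_def mult_single)

lemma const_one: "const 1 = (1 :: ('x, 'b::comm_ring_1) mpolynomial)"
  by (simp add: const_def)

interpretation mpoly: vector_space "\<lambda>c (p :: 'a::field mat_poly). const c * p"
  by unfold_locales (simp_all add: algebra_simps const_add const_mult const_one)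

section \<open>Renaming variables\<close>

text \<open>
  The map of exponent vectors induced by a renaming \<open>f\<close> of variables, where \<open>f\<close> may identify
  variables.  Applied twice, \<open>push (push f)\<close> is the induced homomorphism of polynomial rings,
  because a polynomial is itself a finitely supported function on exponent vectors.
\<close>

definition push :: "('x \<Rightarrow> 'y) \<Rightarrow> ('x \<Rightarrow>\<^sub>0 'b::comm_monoid_add) \<Rightarrow> 'y \<Rightarrow>\<^sub>0 'b" where
  "push f p = (\<Sum>x\<in>Poly_Mapping.keys p. Poly_Mapping.single (f x) (Poly_Mapping.lookup p x))"

lemma push_superset:
  assumes "finite K" "Poly_Mapping.keys p \<subseteq> K"
  shows "push f p = (\<Sum>x\<in>K. Poly_Mapping.single (f x) (Poly_Mapping.lookup p x))"
  unfolding push_def by (rule sum.mono_neutral_left) (use assms in \<open>auto simp: in_keys_iff\<close>)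

lemma push_zero [simp]: "push f 0 = 0"
  by (simp add: push_def)

lemma push_single [simp]: "push f (Poly_Mapping.single x c) = Poly_Mapping.single (f x) c"
  by (simp add: push_def)

lemma push_add: "push f (p + q) = push f p + push f q"
proof -
  define K where "K = Poly_Mapping.keys p \<union> Poly_Mapping.keys q"
  have "finite K" "Poly_Mapping.keys (p + q) \<subseteq> K" "Poly_Mapping.keys p \<subseteq> K" "Poly_Mapping.keys q \<subseteq> K"
    using Poly_Mapping.keys_add[of p q] by (auto simp: K_def)
  then show ?thesis
    by (simp add: push_superset[where K = K] lookup_add single_add sum.distrib)
qed

lemma push_push: "push f (push g p) = push (f \<circ> g) p"
  by (induction p rule: poly_mapping_additive_induct) (simp_all add: push_add)

lemma lookup_push:
  "Poly_Mapping.lookup (push f p) y =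
    (\<Sum>x\<in>Poly_Mapping.keys p. Poly_Mapping.lookup p x when f x = y)"
  by (simp add: push_def lookup_sum lookup_single)

lemma keys_push_subset: "Poly_Mapping.keys (push f p) \<subseteq> f ` Poly_Mapping.keys p"
  unfolding push_def by (rule order.trans[OF Poly_Mapping.keys_sum]) (auto split: if_splits)

lemma keys_push_nat:
  fixes p :: "'x \<Rightarrow>\<^sub>0 nat"
  shows "Poly_Mapping.keys (push f p) = f ` Poly_Mapping.keys p"
proof (intro equalityI keys_push_subset subsetI)
  fix y assume "y \<in> f ` Poly_Mapping.keys p"
  then obtain x where "x \<in> Poly_Mapping.keys p" "y = f x" by blast
  then show "y \<in> Poly_Mapping.keys (push f p)"
    by (auto simp: in_keys_iff lookup_push when_def intro!: bexI[of _ x])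
qed

lemma push_id [simp]: "push (\<lambda>x. x) p = p"
  using poly_mapping_sum_single[of p] by (simp add: push_def)

lemma push_cong: "(\<And>x. x \<in> Poly_Mapping.keys p \<Longrightarrow> f x = g x) \<Longrightarrow> push f p = push g p"
  by (simp add: push_def)

lemma lookup_push_involution:
  assumes "\<And>x. f (f x) = x"
  shows "Poly_Mapping.lookup (push f p) y = Poly_Mapping.lookup p (f y)"
proof -
  have *: "f x = y \<longleftrightarrow> x = f y" for x y using assms by metis
  show ?thesis by (induction p rule: poly_mapping_additive_induct)
      (auto simp: push_add lookup_add lookup_single when_def *)
qed

lemma push_mult:
  fixes p q :: "'k::cancel_comm_monoid_add \<Rightarrow>\<^sub>0 'b::comm_semiring_0"
    and f :: "'k \<Rightarrow> 'l::cancel_comm_monoid_add"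
  assumes "\<And>x y. f (x + y) = f x + f y"
  shows "push f (p * q) = push f p * push f q"
proof (induction p rule: poly_mapping_additive_induct)
  case (single x c)
  show ?case by (induction q rule: poly_mapping_additive_induct)
      (simp_all add: mult_single push_add distrib_left assms)
qed (simp_all add: push_add distrib_right)

lemma push_const_mult:
  fixes p :: "('x, 'b::comm_semiring_0) mpolynomial" and f :: "_ \<Rightarrow> ('y \<Rightarrow>\<^sub>0 nat)"
  shows "push f (const c * p) = const c * push f p"
  by (induction p rule: poly_mapping_additive_induct)
     (simp_all add: push_add distrib_left const_def mult_single)

section \<open>Power series as a module over the polynomial ring\<close>

text \<open>
  Multiplication of a power series by the monomial with exponent vector \<open>m\<close>.  Every product of a
  polynomial with a power series is a linear combination of such shifts
  (\<open>poly_times_series_eq\<close>), which turns power series into a module over the polynomial ring.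
\<close>

definition shift :: "degree \<Rightarrow> (degree \<Rightarrow> int) \<Rightarrow> degree \<Rightarrow> int" where
  "shift m H d = (if \<exists>e. d = m + e then H (d - m) else 0)"

lemma shift_add: "shift (a + b) H = shift a (shift b H)"
proof
  fix d
  show "shift (a + b) H d = shift a (shift b H) d"
  proof (cases "\<exists>e. d = a + b + e")
    case True
    then obtain e where "d = a + (b + e)" by (auto simp: add.assoc)
    then show ?thesis by (auto simp: shift_def add.assoc diff_diff_add[symmetric] simp del: diff_diff_add)
  next
    case False
    then show ?thesis by (auto simp: shift_def add.assoc)
  qed
qed

lemma shift_shifted [simp]: "shift m H (m + e) = H e"
  by (auto simp: shift_def)

lemma shift_linear: "shift m (\<lambda>d. a * H d + b * G d) d = a * shift m H d + b * shift m G d"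
  by (simp add: shift_def)

lemma poly_times_series_eq:
  "poly_times_series P H d = (\<Sum>m\<in>Poly_Mapping.keys P. Poly_Mapping.lookup P m * shift m H d)"
proof -
  define A where "A = {m \<in> Poly_Mapping.keys P. \<exists>e. d = m + e}"
  have "{(m, e). m \<in> Poly_Mapping.keys P \<and> m + e = d} = (\<lambda>m. (m, d - m)) ` A"
    by (auto simp: A_def)
  then have "poly_times_series P H d = (\<Sum>m\<in>A. Poly_Mapping.lookup P m * H (d - m))"
    unfolding poly_times_series_def by (simp add: sum.reindex inj_on_def)
  also have "\<dots> = (\<Sum>m\<in>A. Poly_Mapping.lookup P m * shift m H d)"
    by (rule sum.cong) (auto simp: A_def shift_def)
  also have "\<dots> = (\<Sum>m\<in>Poly_Mapping.keys P. Poly_Mapping.lookup P m * shift m H d)"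
    by (rule sum.mono_neutral_left) (auto simp: A_def shift_def)
  finally show ?thesis .
qed

lemma poly_times_series_superset:
  assumes "finite K" "Poly_Mapping.keys P \<subseteq> K"
  shows "poly_times_series P H d = (\<Sum>m\<in>K. Poly_Mapping.lookup P m * shift m H d)"
  unfolding poly_times_series_eq
  by (rule sum.mono_neutral_left) (use assms in \<open>auto simp: in_keys_iff\<close>)

lemma poly_times_series_zero [simp]: "poly_times_series 0 H d = 0"
  by (simp add: poly_times_series_eq)

lemma poly_times_series_single [simp]:
  "poly_times_series (Poly_Mapping.single m c) H d = c * shift m H d"
  by (simp add: poly_times_series_eq)

lemma poly_times_series_add:
  "poly_times_series (P + Q) H d = poly_times_series P H d + poly_times_series Q H d"
proof -
  define K where "K = Poly_Mapping.keys P \<union> Poly_Mapping.keys Q"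
  have "finite K" "Poly_Mapping.keys (P + Q) \<subseteq> K" "Poly_Mapping.keys P \<subseteq> K" "Poly_Mapping.keys Q \<subseteq> K"
    using Poly_Mapping.keys_add[of P Q] by (auto simp: K_def)
  then show ?thesis
    by (simp add: poly_times_series_superset[where K = K] lookup_add distrib_right sum.distrib)
qed

lemma poly_times_series_uminus: "poly_times_series (- P) H d = - poly_times_series P H d"
  using poly_times_series_add[of "- P" P H d] by simp

lemma poly_times_series_diff:
  "poly_times_series (P - Q) H d = poly_times_series P H d - poly_times_series Q H d"
  using poly_times_series_add[of P "- Q" H d] by (simp add: poly_times_series_uminus)

lemma poly_times_series_linear:
  "poly_times_series P (\<lambda>d. a * H d + b * G d) d =
    a * poly_times_series P H d + b * poly_times_series P G d"
  by (simp add: poly_times_series_eq shift_linear sum.distrib sum_distrib_left algebra_simps)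

lemma poly_times_series_mult:
  "poly_times_series (P * Q) H d = poly_times_series P (poly_times_series Q H) d"
proof (induction P arbitrary: d rule: poly_mapping_additive_induct)
  case (single m c)
  show ?case
  proof (induction Q arbitrary: d rule: poly_mapping_additive_induct)
    case (single m' c')
    show ?case using shift_linear[of m c' "shift m' H" 0 "shift m' H"]
      by (simp add: mult_single shift_add)
  next
    case (add P Q)
    have "shift m (\<lambda>d. poly_times_series P H d + poly_times_series Q H d) d =
        shift m (poly_times_series P H) d + shift m (poly_times_series Q H) d"
      using shift_linear[of m 1 "poly_times_series P H" 1 "poly_times_series Q H" d]
      by simp
    with add show ?case by (simp add: distrib_left poly_times_series_add[abs_def])
  qed (simp add: shift_def)
qed (simp_all add: distrib_right poly_times_series_add)

text \<open>
  A polynomial, seen as a power series through its coefficients, is multiplied in the same way in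
  both rings.
\<close>

lemma poly_times_series_lookup:
  "poly_times_series P (Poly_Mapping.lookup Q) d = Poly_Mapping.lookup (P * Q) d"
  by (induction P rule: poly_mapping_additive_induct)
     (simp_all add: distrib_right lookup_add poly_times_series_add lookup_single_mult shift_def)

lemma poly_times_series_one [simp]: "poly_times_series 1 H d = H d"
  using poly_times_series_single[of 0 1 H d] shift_shifted[of 0 H d] by simp

text \<open>
  Permuting the variables by an involution is compatible with the module structure.
\<close>

lemma poly_times_series_push:
  assumes inv: "\<And>d. f (f d) = d" and add: "\<And>a b. f (a + b) = f a + f b"
  shows "poly_times_series (push f P) (\<lambda>e. H (f e)) d = poly_times_series P H (f d)"
proof (induction P rule: poly_mapping_additive_induct)
  case (single m c)
  have "(\<exists>e. d = f m + e) \<longleftrightarrow> (\<exists>e. f d = m + e)"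
    using inv add by metis
  moreover have "f (d - f m) = f d - m" if "d = f m + e" for e
    using that by (simp add: add inv)
  ultimately show ?case by (auto simp: shift_def)
qed (simp_all add: push_add poly_times_series_add)

text \<open>
  A pair of indices names one matrix variable, so quantifiers over pairs are kept intact.
\<close>

declare split_paired_All [simp del] split_paired_Ex [simp del]

section \<open>Counting monomials by multidegree\<close>

type_synonym monomial = "nat \<times> nat \<Rightarrow>\<^sub>0 nat"

definition var_degree :: "nat \<times> nat \<Rightarrow> degree" where
  "var_degree x = Poly_Mapping.single (U (fst x)) 1 + Poly_Mapping.single (T (snd x)) 1"

lemma multidegree_push: "multidegree m = push (U \<circ> fst) m + push (T \<circ> snd) m"
  by (simp add: multidegree_def push_def sum.distrib case_prod_beta)

lemma multidegree_add: "multidegree (a + b) = multidegree a + multidegree b"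
  by (simp add: multidegree_push push_add ac_simps)

lemma multidegree_single [simp]:
  "multidegree (Poly_Mapping.single x k) = Poly_Mapping.single (U (fst x)) k + Poly_Mapping.single (T (snd x)) k"
  by (simp add: multidegree_push)

lemma lookup_multidegree_U:
  "Poly_Mapping.lookup (multidegree m) (U i) = (\<Sum>x\<in>Poly_Mapping.keys m. Poly_Mapping.lookup m x when fst x = i)"
  by (simp add: multidegree_push lookup_add lookup_push)

lemma lookup_multidegree_T:
  "Poly_Mapping.lookup (multidegree m) (T j) = (\<Sum>x\<in>Poly_Mapping.keys m. Poly_Mapping.lookup m x when snd x = j)"
  by (simp add: multidegree_push lookup_add lookup_push)

lemma lookup_le_multidegree_U:
  "Poly_Mapping.lookup m x \<le> Poly_Mapping.lookup (multidegree m) (U (fst x))"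
proof (cases "x \<in> Poly_Mapping.keys m")
  case True
  have "(Poly_Mapping.lookup m x when fst x = fst x) \<le> (\<Sum>y\<in>Poly_Mapping.keys m. Poly_Mapping.lookup m y when fst y = fst x)"
    by (rule member_le_sum) (use True in auto)
  then show ?thesis by (simp add: lookup_multidegree_U)
qed (simp add: in_keys_iff)

lemma lookup_le_multidegree_T:
  "Poly_Mapping.lookup m x \<le> Poly_Mapping.lookup (multidegree m) (T (snd x))"
proof (cases "x \<in> Poly_Mapping.keys m")
  case True
  have "(Poly_Mapping.lookup m x when snd x = snd x) \<le> (\<Sum>y\<in>Poly_Mapping.keys m. Poly_Mapping.lookup m y when snd y = snd x)"
    by (rule member_le_sum) (use True in auto)
  then show ?thesis by (simp add: lookup_multidegree_T)
qed (simp add: in_keys_iff)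

text \<open>
  Each exponent of a monomial is bounded by the exponents of its row and its column in the
  multidegree, and its row and column must occur there.
\<close>

lemma finite_multidegree_fiber: "finite {m. multidegree m = d}"
proof -
  define A where "A = the_inv U ` Poly_Mapping.keys d \<times> the_inv T ` Poly_Mapping.keys d"
  define N where "N = (\<Sum>y\<in>Poly_Mapping.keys d. Poly_Mapping.lookup d y)"
  have le_N: "Poly_Mapping.lookup d y \<le> N" for y
    by (cases "y \<in> Poly_Mapping.keys d") (auto simp: N_def in_keys_iff intro: member_le_sum)
  have inj: "inj U" "inj T" by (auto simp: inj_on_def)
  have "Poly_Mapping.lookup ` {m. multidegree m = d} \<subseteq>
      {f. \<forall>x. (x \<in> A \<longrightarrow> f x \<in> {..N}) \<and> (x \<notin> A \<longrightarrow> f x = 0)}"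
  proof (clarsimp, intro conjI impI)
    fix i j m assume d: "d = multidegree m"
    show "Poly_Mapping.lookup m (i, j) \<le> N"
      using lookup_le_multidegree_U[of m "(i, j)"] le_N[of "U i"] d by simp
    assume "(i, j) \<notin> A"
    moreover have "(i, j) \<in> A" if "0 < Poly_Mapping.lookup m (i, j)"
    proof -
      have "U i \<in> Poly_Mapping.keys d" "T j \<in> Poly_Mapping.keys d"
        using lookup_le_multidegree_U[of m "(i, j)"] lookup_le_multidegree_T[of m "(i, j)"] that d
        by (auto simp: in_keys_iff)
      then show ?thesis unfolding A_def
        using imageI[of "U i" _ "the_inv U"] imageI[of "T j" _ "the_inv T"]
        by (simp add: the_inv_f_f[OF inj(1)] the_inv_f_f[OF inj(2)])
    qed
    ultimately show "Poly_Mapping.lookup m (i, j) = 0" by blast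
  qed
  moreover have "finite A" by (simp add: A_def)
  ultimately have "finite (Poly_Mapping.lookup ` {m. multidegree m = d})"
    using finite_set_of_finite_funs[of A "{..N}" 0] finite_subset by blast
  then show ?thesis by (rule finite_imageD) (simp add: inj_on_def)
qed

definition counting_series :: "monomial set \<Rightarrow> degree \<Rightarrow> int" where
  "counting_series N d = int (card {m \<in> N. multidegree m = d})"

lemma counting_series_disjoint_union:
  assumes "A \<inter> B = {}"
  shows "counting_series (A \<union> B) d = counting_series A d + counting_series B d"
proof -
  have "{m \<in> A \<union> B. multidegree m = d} = {m \<in> A. multidegree m = d} \<union> {m \<in> B. multidegree m = d}"
    by blast
  moreover have "finite {m \<in> A. multidegree m = d}" for A :: "monomial set"
    by (rule finite_subset[OF _ finite_multidegree_fiber[of d]]) blast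
  ultimately show ?thesis
    using assms by (simp add: counting_series_def card_Un_disjoint disjoint_iff)
qed

lemma counting_series_translate:
  "counting_series ((+) g ` N) d = shift (multidegree g) (counting_series N) d"
proof (cases "\<exists>e. d = multidegree g + e")
  case True
  then obtain e where e: "d = multidegree g + e" by blast
  have "{m \<in> (+) g ` N. multidegree m = d} = (+) g ` {m \<in> N. multidegree m = e}"
    by (auto simp: e multidegree_add)
  then show ?thesis by (simp add: e counting_series_def card_image)
next
  case False
  then have empty: "{m \<in> (+) g ` N. multidegree m = d} = {}" by (auto simp: multidegree_add)
  from False show ?thesis unfolding counting_series_def empty by (simp add: shift_def)
qed

definition monomials :: "(nat \<times> nat) set \<Rightarrow> monomial set" where
  "monomials S = {m. Poly_Mapping.keys m \<subseteq> S}"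

lemma keys_add_nat:
  fixes a b :: "'x \<Rightarrow>\<^sub>0 nat"
  shows "Poly_Mapping.keys (a + b) = Poly_Mapping.keys a \<union> Poly_Mapping.keys b"
  by (auto simp: in_keys_iff lookup_add)

lemma monomials_add [simp]: "a + b \<in> monomials S \<longleftrightarrow> a \<in> monomials S \<and> b \<in> monomials S"
  by (auto simp: monomials_def keys_add_nat)

definition divides :: "monomial \<Rightarrow> monomial \<Rightarrow> bool" where
  "divides a b \<longleftrightarrow> (\<forall>x. Poly_Mapping.lookup a x \<le> Poly_Mapping.lookup b x)"

lemma divides_iff: "divides a b \<longleftrightarrow> (\<exists>c. b = a + c)"
proof
  assume "divides a b"
  then have "b = a + (b - a)"
    by (intro poly_mapping_eqI) (simp add: divides_def lookup_add lookup_minus)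
  then show "\<exists>c. b = a + c" ..
qed (auto simp: divides_def lookup_add)

text \<open>
  Subtraction of exponent vectors is truncated, so \<open>h - g\<close> is the exponent vector of
  \<open>h / gcd(h, g)\<close>: this is the colon ideal of a principal monomial ideal.
\<close>

lemma divides_add_iff: "divides h (g + m) \<longleftrightarrow> divides (h - g) m"
  by (auto simp: divides_def lookup_add lookup_minus diff_le_eq le_diff_conv add.commute)

text \<open>
  The monomials outside the monomial ideal generated by \<open>G\<close>.
\<close>

definition standard_monomials :: "(nat \<times> nat) set \<Rightarrow> monomial set \<Rightarrow> monomial set" where
  "standard_monomials S G = {m \<in> monomials S. \<forall>g\<in>G. \<not> divides g m}"

definition denominator :: "(nat \<times> nat) set \<Rightarrow> ut_poly" where
  "denominator S = (\<Prod>(i, j)\<in>S. 1 - var (U i) * var (T j))"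

lemma denominator_factor:
  "(case x of (i, j) \<Rightarrow> 1 - var (U i) * var (T j)) = (1 - Poly_Mapping.single (var_degree x) 1 :: ut_poly)"
  by (cases x) (simp add: var_def mult_single var_degree_def)

text \<open>
  The standard monomials of \<open>G\<close> that \<open>g\<close> divides are \<open>g\<close> times the standard monomials of the colon
  ideal.  On the level of ideals this is the exact sequence
  \<open>0 \<rightarrow> R / (J : g) \<rightarrow> R / J \<rightarrow> R / (J + (g)) \<rightarrow> 0\<close> for the monomial ideal \<open>J\<close> generated by \<open>G\<close>.
\<close>

lemma counting_series_split:
  assumes "g \<in> monomials S"
  shows "counting_series (standard_monomials S G) d =
    counting_series (standard_monomials S (insert g G)) d +
    shift (multidegree g) (counting_series (standard_monomials S ((\<lambda>h. h - g) ` G))) d"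
proof -
  have "standard_monomials S G = standard_monomials S (insert g G) \<union>
      (+) g ` standard_monomials S ((\<lambda>h. h - g) ` G)" (is "_ = _ \<union> ?B")
  proof (intro equalityI subsetI)
    fix m assume m: "m \<in> standard_monomials S G"
    show "m \<in> standard_monomials S (insert g G) \<union> ?B"
    proof (cases "divides g m")
      case True
      then obtain c where c: "m = g + c" by (auto simp: divides_iff)
      with m have "c \<in> standard_monomials S ((\<lambda>h. h - g) ` G)"
        by (auto simp: standard_monomials_def divides_add_iff)
      with c show ?thesis by blast
    qed (use m in \<open>auto simp: standard_monomials_def\<close>)
  next
    fix m assume "m \<in> standard_monomials S (insert g G) \<union> ?B"
    then show "m \<in> standard_monomials S G"
      using assms by (auto simp: standard_monomials_def divides_add_iff)
  qed
  moreover have "standard_monomials S (insert g G) \<inter> ?B = {}"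
    by (auto simp: standard_monomials_def divides_iff)
  ultimately show ?thesis
    by (simp add: counting_series_disjoint_union counting_series_translate)
qed

text \<open>
  The Hilbert series of a polynomial ring is the inverse of the denominator.  Adding a variable
  \<open>x\<^sub>i\<^sub>j\<close> multiplies the denominator by \<open>1 - u\<^sub>i t\<^sub>j\<close>, and the splitting with respect to the single
  generator \<open>x\<^sub>i\<^sub>j\<close> shows that this factor turns the larger series into the smaller one.
\<close>

lemma denominator_times_monomials:
  assumes "finite S"
  shows "poly_times_series (denominator S) (counting_series (monomials S)) = Poly_Mapping.lookup 1"
  using assms
proof (induction S rule: finite_induct)
  case empty
  have "counting_series (monomials {}) d = Poly_Mapping.lookup 1 d" for d
  proof -
    have "{m \<in> monomials {}. multidegree m = d} = (if d = 0 then {0} else {})"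
      by (auto simp: monomials_def multidegree_def)
    then show ?thesis by (simp add: counting_series_def lookup_one when_def)
  qed
  then show ?case by (auto simp: denominator_def)
next
  case (insert x S)
  let ?x = "Poly_Mapping.single x 1 :: monomial"
  have x: "multidegree ?x = var_degree x" by (simp add: var_degree_def)
  have "standard_monomials (insert x S) {?x} = monomials S"
  proof -
    have "divides ?x m \<longleftrightarrow> x \<in> Poly_Mapping.keys m" for m
      by (auto simp: divides_def lookup_single when_def in_keys_iff Suc_le_eq)
    then show ?thesis using insert.hyps by (auto simp: standard_monomials_def monomials_def)
  qed
  moreover have "standard_monomials S' {} = monomials S'" for S'
    by (simp add: standard_monomials_def)
  ultimately have "counting_series (monomials (insert x S)) d = counting_series (monomials S) d +
      shift (var_degree x) (counting_series (monomials (insert x S))) d" for d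
    using counting_series_split[of ?x "insert x S" "{}" d] x by (simp add: monomials_def)
  then have "poly_times_series (1 - Poly_Mapping.single (var_degree x) 1)
      (counting_series (monomials (insert x S))) = counting_series (monomials S)"
    by (intro ext) (simp add: poly_times_series_diff)
  moreover have "denominator (insert x S) = denominator S * (1 - Poly_Mapping.single (var_degree x) 1)"
    using insert.hyps denominator_factor[of x]
    by (simp add: denominator_def mult.commute[of "prod _ _"])
  ultimately show ?case
    by (intro ext) (simp only: poly_times_series_mult insert.IH)
qed

text \<open>
  Splitting off one generator leaves two monomial ideals with fewer generators.
\<close>

lemma denominator_times_standard_monomials:
  assumes "finite S" "finite G" "G \<subseteq> monomials S"
  shows "\<exists>P. poly_times_series (denominator S) (counting_series (standard_monomials S G)) =
    Poly_Mapping.lookup P"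
  using assms(2,3)
proof (induction "card G" arbitrary: G rule: less_induct)
  case less
  show ?case
  proof (cases "G = {}")
    case True
    then show ?thesis using denominator_times_monomials[OF assms(1)]
      by (auto simp: standard_monomials_def)
  next
    case False
    then obtain g where g: "g \<in> G" by blast
    define G' where "G' = G - {g}"
    have G: "G = insert g G'" and card: "card G' < card G"
      using g less.prems(1) card_Diff1_less[of G g] by (auto simp: G'_def)
    define Q where "Q = (\<lambda>h. h - g) ` G'"
    have "Q \<subseteq> monomials S"
      using less.prems(2) by (fastforce simp: Q_def G'_def monomials_def in_keys_iff lookup_minus)
    moreover have "card Q < card G" "finite Q"
      using card card_image_le[of G' "\<lambda>h. h - g"] less.prems(1) by (auto simp: Q_def G'_def)
    ultimately obtain P2 where P2:
      "poly_times_series (denominator S) (counting_series (standard_monomials S Q)) = Poly_Mapping.lookup P2"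
      using less.hyps by blast
    obtain P1 where P1:
      "poly_times_series (denominator S) (counting_series (standard_monomials S G')) = Poly_Mapping.lookup P1"
      using less.hyps[OF card] less.prems by (auto simp: G'_def)
    \<comment> \<open>The series of \<open>G\<close> is that of \<open>G'\<close> minus the shifted series of the colon ideal \<open>Q\<close>.\<close>
    let ?g = "Poly_Mapping.single (multidegree g) 1 :: ut_poly"
    have "counting_series (standard_monomials S G) = (\<lambda>d. 1 * counting_series (standard_monomials S G') d +
        (- 1) * poly_times_series ?g (counting_series (standard_monomials S Q)) d)"
      using counting_series_split[of g S G'] g less.prems(2) by (auto simp: G Q_def)
    then have "poly_times_series (denominator S) (counting_series (standard_monomials S G)) d =
       poly_times_series (denominator S) (counting_series (standard_monomials S G')) d
       - poly_times_series (denominator S * ?g) (counting_series (standard_monomials S Q)) d" for d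
      by (simp only: poly_times_series_linear poly_times_series_mult)
    moreover have "poly_times_series (denominator S * ?g) (counting_series (standard_monomials S Q)) d =
        Poly_Mapping.lookup (?g * P2) d" for d
      unfolding mult.commute[of "denominator S"] poly_times_series_mult P2 poly_times_series_lookup ..
    ultimately have "poly_times_series (denominator S) (counting_series (standard_monomials S G)) =
        Poly_Mapping.lookup (P1 - ?g * P2)"
      by (simp add: P1 fun_eq_iff lookup_minus)
    then show ?thesis by blast
  qed
qed

section \<open>Dickson's lemma\<close>

text \<open>
  Dominance is only required on the coordinates in \<open>S\<close>, which makes an induction on \<open>S\<close> possible.
  For a new coordinate \<open>x\<close>, a finite set \<open>G\<close> that works for \<open>S\<close> dominates every element of \<open>M\<close> whose
  \<open>x\<close>-coordinate is at least the bound \<open>K\<close> of those in \<open>G\<close>.  The rest of \<open>M\<close> falls into finitely many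
  slices on which \<open>x\<close> is constant, and each slice is covered by the induction hypothesis.
\<close>

lemma dickson:
  fixes f :: "'m \<Rightarrow> 'x \<Rightarrow> nat"
  assumes "finite S"
  shows "\<exists>G. finite G \<and> G \<subseteq> M \<and> (\<forall>m\<in>M. \<exists>g\<in>G. \<forall>x\<in>S. f g x \<le> f m x)"
  using assms
proof (induction S arbitrary: M rule: finite_induct)
  case empty
  show ?case
  proof (cases "M = {}")
    case False
    then obtain m where "m \<in> M" by blast
    then show ?thesis by (intro exI[of _ "{m}"]) auto
  qed auto
next
  case (insert x S)
  obtain G where G: "finite G" "G \<subseteq> M" "\<forall>m\<in>M. \<exists>g\<in>G. \<forall>x\<in>S. f g x \<le> f m x"
    using insert.IH[of M] by (elim exE conjE) (rule that)
  define K where "K = (\<Sum>g\<in>G. f g x)"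
  have K: "f g x \<le> K" if "g \<in> G" for g
    using that G(1) unfolding K_def by (intro member_le_sum) auto
  have "\<exists>G'. finite G' \<and> G' \<subseteq> {m\<in>M. f m x = k} \<and>
      (\<forall>m\<in>{m\<in>M. f m x = k}. \<exists>g\<in>G'. \<forall>x\<in>S. f g x \<le> f m x)" for k
    by (rule insert.IH)
  from choice[OF allI, OF this] obtain H where "\<forall>k. finite (H k) \<and> H k \<subseteq> {m\<in>M. f m x = k} \<and>
      (\<forall>m\<in>{m\<in>M. f m x = k}. \<exists>g\<in>H k. \<forall>x\<in>S. f g x \<le> f m x)" by (rule exE)
  then have H: "\<And>k. finite (H k)" "\<And>k. H k \<subseteq> {m\<in>M. f m x = k}"
      "\<And>k. \<forall>m\<in>{m\<in>M. f m x = k}. \<exists>g\<in>H k. \<forall>x\<in>S. f g x \<le> f m x"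
    by auto
  show ?case
  proof (intro exI[of _ "G \<union> (\<Union>k<K. H k)"] conjI ballI)
    fix m assume m: "m \<in> M"
    show "\<exists>g\<in>G \<union> (\<Union>k<K. H k). \<forall>x\<in>insert x S. f g x \<le> f m x"
    proof (cases "f m x < K")
      case True
      obtain g where "g \<in> H (f m x)" "\<forall>x\<in>S. f g x \<le> f m x" using H(3) m by blast
      moreover from this have "f g x = f m x" using H(2) by blast
      ultimately show ?thesis using True by (intro bexI[of _ g]) auto
    next
      case False
      obtain g where "g \<in> G" "\<forall>x\<in>S. f g x \<le> f m x" using G(3) m by blast
      then show ?thesis using K[of g] False by (intro bexI[of _ g]) auto
    qed
  qed (use G(1,2) H(1) subsetD[OF H(2)] in auto)
qed

lemma up_set_standard_monomials:
  assumes "finite S" "M \<subseteq> monomials S"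
    and "\<And>a b. a \<in> M \<Longrightarrow> b \<in> monomials S \<Longrightarrow> b + a \<in> M"
  shows "\<exists>G. finite G \<and> G \<subseteq> monomials S \<and> monomials S - M = standard_monomials S G"
proof -
  obtain G where G: "finite G" "G \<subseteq> M" "\<forall>m\<in>M. \<exists>g\<in>G. \<forall>x\<in>S. Poly_Mapping.lookup g x \<le> Poly_Mapping.lookup m x"
    using dickson[OF assms(1), of M Poly_Mapping.lookup] by (elim exE conjE) (rule that)
  have "m \<in> M \<longleftrightarrow> (\<exists>g\<in>G. divides g m)" if m: "m \<in> monomials S" for m
  proof
    assume "m \<in> M"
    then obtain g where g: "g \<in> G" "\<forall>x\<in>S. Poly_Mapping.lookup g x \<le> Poly_Mapping.lookup m x" using G by blast
    have "Poly_Mapping.lookup g x = 0" if "x \<notin> S" for x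
      using g(1) G(2) assms(2) that by (auto simp: monomials_def in_keys_iff subset_iff)
    with g have "divides g m" by (metis divides_def le0)
    with g show "\<exists>g\<in>G. divides g m" by blast
  next
    assume "\<exists>g\<in>G. divides g m"
    then obtain g c where "g \<in> G" "m = g + c" by (auto simp: divides_iff)
    with m show "m \<in> M" using assms(3)[of g c] G(2) by (auto simp: add.commute)
  qed
  then have "monomials S - M = standard_monomials S G" by (auto simp: standard_monomials_def)
  with G assms(2) show ?thesis by blast
qed

section \<open>Dimension of a quotient\<close>

text \<open>
  Replacing each element of \<open>B\<close> by a combination of \<open>C\<close> in the same coset of \<open>I\<close> gives a linearly
  independent family in the span of \<open>C\<close>, to which the usual bound applies.
\<close>

lemma is_basis_mod_card_le:
  fixes I :: "'a::field mat_poly set"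
  assumes I: "mpoly.subspace I"
    and B: "finite B" "\<And>c. (\<Sum>b\<in>B. const (c b) * b) \<in> I \<Longrightarrow> \<forall>b\<in>B. c b = 0"
    and C: "finite C" "\<And>p. p \<in> B \<Longrightarrow> \<exists>c. p - (\<Sum>b\<in>C. const (c b) * b) \<in> I"
  shows "card B \<le> card C"
proof -
  have "\<forall>b\<in>B. \<exists>y. y \<in> mpoly.span C \<and> b - y \<in> I"
  proof
    fix b assume "b \<in> B"
    then obtain c where "b - (\<Sum>b\<in>C. const (c b) * b) \<in> I" using C(2) by blast
    moreover have "(\<Sum>b\<in>C. const (c b) * b) \<in> mpoly.span C"
      by (intro mpoly.span_sum mpoly.span_scale mpoly.span_base)
    ultimately show "\<exists>y. y \<in> mpoly.span C \<and> b - y \<in> I" by blast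
  qed
  then obtain y where y: "\<And>b. b \<in> B \<Longrightarrow> y b \<in> mpoly.span C" "\<And>b. b \<in> B \<Longrightarrow> b - y b \<in> I"
    using bchoice[of B] by metis
  have zero: "\<forall>b\<in>B. c b = 0" if "(\<Sum>b\<in>B. const (c b) * y b) = 0" for c
  proof (rule B(2))
    have "(\<Sum>b\<in>B. const (c b) * b) = (\<Sum>b\<in>B. const (c b) * (b - y b))"
      using that by (simp add: right_diff_distrib sum_subtractf)
    also have "\<dots> \<in> I" using y(2) by (intro mpoly.subspace_sum[OF I] mpoly.subspace_scale[OF I])
    finally show "(\<Sum>b\<in>B. const (c b) * b) \<in> I" .
  qed
  have inj: "inj_on y B"
  proof (rule inj_onI, rule ccontr)
    fix b b' assume b: "b \<in> B" "b' \<in> B" "y b = y b'" "b \<noteq> b'"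
    define c where "c x = (if x = b then 1 else if x = b' then -1 else 0 :: 'a)" for x
    have "(\<Sum>x\<in>B. const (c x) * y x) = (\<Sum>x\<in>{b, b'}. const (c x) * y x)"
      by (rule sum.mono_neutral_right) (use b B(1) in \<open>auto simp: c_def const_def\<close>)
    also have "\<dots> = 0" using b(3,4) by (simp add: c_def const_def single_uminus)
    finally show False using zero[of c] b by (auto simp: c_def)
  qed
  have "mpoly.independent (y ` B)"
    unfolding mpoly.dependent_finite[OF finite_imageI[OF B(1)]]
  proof
    assume "\<exists>u. (\<exists>v\<in>y ` B. u v \<noteq> 0) \<and> (\<Sum>v\<in>y ` B. const (u v) * v) = 0"
    then obtain u b where u: "b \<in> B" "u (y b) \<noteq> 0" "(\<Sum>v\<in>y ` B. const (u v) * v) = 0" by blast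
    then have "(\<Sum>b\<in>B. const (u (y b)) * y b) = 0" by (simp add: sum.reindex[OF inj])
    from zero[OF this] u show False by blast
  qed
  then have "card (y ` B) \<le> card C"
    using mpoly.independent_span_bound[OF C(1), of "y ` B"] y(1) by blast
  then show ?thesis by (simp add: card_image[OF inj])
qed

lemma quotient_dim_eqI:
  assumes I: "mpoly.subspace I" and B: "is_basis_mod V I B"
  shows "quotient_dim V I = card B"
  unfolding quotient_dim_def
proof (rule the_equality)
  show "\<exists>B'. is_basis_mod V I B' \<and> card B' = card B" using B by blast
next
  fix k assume "\<exists>B'. is_basis_mod V I B' \<and> card B' = k"
  then obtain B' where B': "is_basis_mod V I B'" "card B' = k" by blast
  have "card B1 \<le> card B2" if "is_basis_mod V I B1" "is_basis_mod V I B2" for B1 B2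
    by (rule is_basis_mod_card_le[OF I]) (use that in \<open>unfold is_basis_mod_def, blast+\<close>)
  then show "k = card B" using B B' by (metis le_antisym)
qed

lemma quotient_dim_eq_0:
  assumes "mpoly.subspace I" "V \<subseteq> I"
  shows "quotient_dim V I = 0"
proof -
  have "is_basis_mod V I {}" using assms by (auto simp: is_basis_mod_def)
  from quotient_dim_eqI[OF assms(1) this] show ?thesis by simp
qed

text \<open>
  A linear surjection \<open>V \<rightarrow> V'\<close> under which \<open>V \<inter> I\<close> is the preimage of \<open>V' \<inter> I'\<close> induces an isomorphism of
  the quotients.
\<close>

lemma quotient_dim_transfer:
  fixes V I V' I' :: "'a::field mat_poly set"
  assumes subspaces: "mpoly.subspace I" "mpoly.subspace I'" "mpoly.subspace V"
    and add: "\<And>p q. \<phi> (p + q) = \<phi> p + \<phi> q"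
    and scale: "\<And>c p. \<phi> (const c * p) = const c * \<phi> p"
    and onto: "\<phi> ` V = V'"
    and iff: "\<And>p. p \<in> V \<Longrightarrow> p \<in> I \<longleftrightarrow> \<phi> p \<in> I'"
    and B: "is_basis_mod V' I' B"
  shows "quotient_dim V I = quotient_dim V' I'"
proof -
  have zero: "\<phi> 0 = 0" using scale[of 0 0] by (simp add: const_def)
  have diff: "\<phi> (p - q) = \<phi> p - \<phi> q" for p q using add[of "p - q" q] by simp
  have sum: "\<phi> (\<Sum>x\<in>A. f x) = (\<Sum>x\<in>A. \<phi> (f x))" for A :: "'a mat_poly set" and f
    by (induction A rule: infinite_finite_induct) (simp_all add: zero add)
  have B': "finite B" "B \<subseteq> V'" "\<And>p. p \<in> V' \<Longrightarrow> \<exists>c. p - (\<Sum>b\<in>B. const (c b) * b) \<in> I'"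
    "\<And>c b. (\<Sum>b\<in>B. const (c b) * b) \<in> I' \<Longrightarrow> b \<in> B \<Longrightarrow> c b = 0"
    using B unfolding is_basis_mod_def by blast+
  have "\<forall>b\<in>B. \<exists>q. q \<in> V \<and> \<phi> q = b" using B'(2) onto by blast
  then obtain \<psi> where \<psi>: "\<And>b. b \<in> B \<Longrightarrow> \<psi> b \<in> V" "\<And>b. b \<in> B \<Longrightarrow> \<phi> (\<psi> b) = b"
    using bchoice[of B] by metis
  have inj: "inj_on \<psi> B" by (metis \<psi>(2) inj_onI)
  have lift: "(\<Sum>b\<in>B. const (c b) * \<psi> b) \<in> V" "\<phi> (\<Sum>b\<in>B. const (c b) * \<psi> b) = (\<Sum>b\<in>B. const (c b) * b)" for c
    using \<psi> by (auto simp: sum scale intro!: mpoly.subspace_sum[OF subspaces(3)] mpoly.subspace_scale[OF subspaces(3)])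
  have "is_basis_mod V I (\<psi> ` B)"
    unfolding is_basis_mod_def
  proof (intro conjI ballI allI impI)
    fix p assume p: "p \<in> V"
    then obtain c where c: "\<phi> p - (\<Sum>b\<in>B. const (c b) * b) \<in> I'" using B'(3) onto by blast
    have "p - (\<Sum>b\<in>B. const (c b) * \<psi> b) \<in> I"
      using c iff[of "p - (\<Sum>b\<in>B. const (c b) * \<psi> b)"] mpoly.subspace_diff[OF subspaces(3) p lift(1)]
      by (simp add: diff lift(2))
    moreover have "(\<Sum>q\<in>\<psi> ` B. const (c (\<phi> q)) * q) = (\<Sum>b\<in>B. const (c b) * \<psi> b)"
      using \<psi>(2) by (simp add: sum.reindex[OF inj])
    ultimately show "\<exists>c. p - (\<Sum>q\<in>\<psi> ` B. const (c q) * q) \<in> I"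
      by (intro exI[of _ "\<lambda>q. c (\<phi> q)"]) simp
  next
    fix c q assume "(\<Sum>q\<in>\<psi> ` B. const (c q) * q) \<in> I" and q: "q \<in> \<psi> ` B"
    then have "(\<Sum>b\<in>B. const (c (\<psi> b)) * \<psi> b) \<in> I" by (simp add: sum.reindex[OF inj])
    then have "(\<Sum>b\<in>B. const (c (\<psi> b)) * b) \<in> I'" using iff[OF lift(1), of "\<lambda>b. c (\<psi> b)"] by (simp only: lift(2))
    then show "c q = 0" using B'(4)[of "\<lambda>b. c (\<psi> b)"] q by blast
  qed (use B'(1) \<psi>(1) in auto)
  then have "quotient_dim V I = card (\<psi> ` B)" by (rule quotient_dim_eqI[OF subspaces(1)])
  also have "\<dots> = quotient_dim V' I'"
    using quotient_dim_eqI[OF subspaces(2) B] by (simp add: card_image[OF inj])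
  finally show ?thesis .
qed

section \<open>Standard monomials of an ideal\<close>

abbreviation index_set :: "nat \<Rightarrow> nat \<Rightarrow> (nat \<times> nat) set" where
  "index_set r n \<equiv> {..<r} \<times> {..<n}"

lemma keys_graded_piece:
  "p \<in> graded_piece r n d \<longleftrightarrow>
    Poly_Mapping.keys p \<subseteq> {m \<in> monomials (index_set r n). multidegree m = d}"
  unfolding graded_piece_def coordinate_ring_def monomials_def by blast

lemma subspace_keys:
  "mpoly.subspace {p :: 'a::field mat_poly. Poly_Mapping.keys p \<subseteq> A}"
proof (rule mpoly.subspaceI)
  fix p q :: "'a mat_poly" assume "p \<in> {p. Poly_Mapping.keys p \<subseteq> A}" "q \<in> {p. Poly_Mapping.keys p \<subseteq> A}"
  then show "p + q \<in> {p. Poly_Mapping.keys p \<subseteq> A}" using Poly_Mapping.keys_add[of p q] by blast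
qed (auto simp: in_keys_iff lookup_const_mult)

lemma subspace_graded_piece: "mpoly.subspace (graded_piece r n d :: 'a::field mat_poly set)"
proof -
  have "graded_piece r n d =
      {p :: 'a mat_poly. Poly_Mapping.keys p \<subseteq> {m \<in> monomials (index_set r n). multidegree m = d}}"
    by (rule Set.set_eqI) (simp only: keys_graded_piece mem_Collect_eq)
  then show ?thesis by (simp only: subspace_keys)
qed

lemma subspace_coordinate_ring: "mpoly.subspace (coordinate_ring r n :: 'a::field mat_poly set)"
proof -
  have "coordinate_ring r n = {p :: 'a mat_poly. Poly_Mapping.keys p \<subseteq> monomials (index_set r n)}"
    by (auto simp: coordinate_ring_def monomials_def)
  then show ?thesis by (simp only: subspace_keys)
qed

text \<open>
  Monomials are compared in the lexicographic order of exponent vectors.  Only homogeneous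
  elements of \<open>I\<close> contribute, because the Hilbert function sees \<open>I\<close> one degree at a time.
\<close>

definition leading_monomials :: "nat \<Rightarrow> nat \<Rightarrow> 'a::field mat_poly set \<Rightarrow> monomial set" where
  "leading_monomials r n I = {Max (Poly_Mapping.keys p) | p d. p \<in> I \<and> p \<noteq> 0 \<and> p \<in> graded_piece r n d}"

lemma keys_monomial_mult:
  fixes p :: "'a::field mat_poly"
  shows "Poly_Mapping.keys (Poly_Mapping.single m 1 * p) = (+) m ` Poly_Mapping.keys p"
  by (auto simp: in_keys_iff lookup_single_mult image_iff split: if_splits)

lemma leading_monomials_subset: "leading_monomials r n I \<subseteq> monomials (index_set r n)"
proof
  fix m assume "m \<in> leading_monomials r n I"
  then obtain p d where "p \<in> I" "p \<noteq> 0" "p \<in> graded_piece r n d" "m = Max (Poly_Mapping.keys p)"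
    unfolding leading_monomials_def mem_Collect_eq by (elim exE conjE)
  moreover from this have "m \<in> Poly_Mapping.keys p" by simp
  ultimately show "m \<in> monomials (index_set r n)" unfolding keys_graded_piece by blast
qed

text \<open>
  The monomial order is translation invariant, so multiplication by a monomial shifts the leading
  monomial.
\<close>

lemma leading_monomials_up_closed:
  fixes I :: "'a::field mat_poly set"
  assumes "\<And>p m. p \<in> I \<Longrightarrow> m \<in> monomials (index_set r n) \<Longrightarrow> Poly_Mapping.single m 1 * p \<in> I"
    and a: "a \<in> leading_monomials r n I" and b: "b \<in> monomials (index_set r n)"
  shows "b + a \<in> leading_monomials r n I"
proof -
  obtain p d where p: "p \<in> I" "p \<noteq> 0" "p \<in> graded_piece r n d" "a = Max (Poly_Mapping.keys p)"
    using a by (auto simp: leading_monomials_def)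
  define q where "q = Poly_Mapping.single b 1 * p"
  have keys: "Poly_Mapping.keys q = (+) b ` Poly_Mapping.keys p"
    by (simp add: q_def keys_monomial_mult)
  have "q \<in> I" using assms(1) p b by (simp add: q_def)
  moreover have "q \<noteq> 0" using keys p(2) by (metis image_is_empty keys_eq_empty)
  moreover have "q \<in> graded_piece r n (multidegree b + d)"
    using p(3) b by (auto simp: keys_graded_piece keys multidegree_add)
  moreover have "Max (Poly_Mapping.keys q) = b + a"
    unfolding keys p(4)
    by (rule mono_Max_commute[symmetric]) (use p(2) in \<open>auto intro: monoI add_left_mono\<close>)
  ultimately show ?thesis unfolding leading_monomials_def by (metis (mono_tags, lifting) mem_Collect_eq)
qed

text \<open>
  Division with remainder: the leading term of \<open>p\<close> is either standard or cancelled by an element of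
  \<open>I\<close>.  The process stops because a degree contains only finitely many monomials.
\<close>

lemma reduce_mod_ideal:
  fixes I :: "'a::field mat_poly set"
  assumes I: "mpoly.subspace I" and p: "p \<in> graded_piece r n d"
    and M: "M = {m \<in> monomials (index_set r n) - leading_monomials r n I. multidegree m = d}"
  shows "\<exists>s \<in> mpoly.span ((\<lambda>m. Poly_Mapping.single m 1) ` M). p - s \<in> I"
proof -
  define Deg where "Deg = {m \<in> monomials (index_set r n). multidegree m = d}"
  have fin: "finite Deg" using finite_multidegree_fiber[of d] by (auto simp: Deg_def intro: finite_subset)
  let ?S = "mpoly.span ((\<lambda>m. Poly_Mapping.single m 1) ` M) :: 'a mat_poly set"
  show ?thesis using p
  proof (induction "card {x \<in> Deg. x \<le> Max (Poly_Mapping.keys p)}" arbitrary: p rule: less_induct)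
    case less
    show ?case
    proof (cases "p = 0")
      case True
      then show ?thesis using mpoly.subspace_0[OF I] mpoly.span_zero by force
    next
      case False
      define m where "m = Max (Poly_Mapping.keys p)"
      have m_key: "m \<in> Poly_Mapping.keys p" using False by (simp add: m_def)
      then have m: "m \<in> Deg" using less.prems by (auto simp: Deg_def keys_graded_piece)
      \<comment> \<open>\<open>q\<close> has the same leading monomial as \<open>p\<close> and is congruent to a standard \<open>s\<close>: the monomial itself, or an element of \<open>I\<close> with \<open>s = 0\<close>.\<close>
      obtain q s where q: "q \<in> graded_piece r n d" "q \<noteq> 0" "Max (Poly_Mapping.keys q) = m"
        and s: "s \<in> ?S" "q - s \<in> I"
      proof (cases "m \<in> M")
        case True
        show ?thesis
        proof (rule that)
          show "Poly_Mapping.single m 1 \<in> graded_piece r n d"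
            using m by (auto simp: keys_graded_piece Deg_def)
          show "Poly_Mapping.single m 1 \<in> ?S" using True by (intro mpoly.span_base) auto
          show "Poly_Mapping.single m 1 - Poly_Mapping.single m 1 \<in> I"
            using mpoly.subspace_0[OF I] by simp
          show "Poly_Mapping.single m (1::'a) \<noteq> 0"
            by (metis keys_eq_empty keys_single insert_not_empty zero_neq_one)
        qed simp
      next
        case False
        then obtain q d' where q: "q \<in> I" "q \<noteq> 0" "q \<in> graded_piece r n d'" "m = Max (Poly_Mapping.keys q)"
          using m by (auto simp: M Deg_def leading_monomials_def)
        have "m \<in> Poly_Mapping.keys q" using q by simp
        then have "d' = d" using q(3) m by (auto simp: keys_graded_piece Deg_def)
        with q show ?thesis using that[of q 0] by (simp add: mpoly.span_zero)
      qed
      have q_key: "m \<in> Poly_Mapping.keys q" using q by (metis Max_in finite_keys keys_eq_empty)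
      define a where "a = Poly_Mapping.lookup p m / Poly_Mapping.lookup q m"
      define p' where "p' = p - const a * q"
      have p': "p' \<in> graded_piece r n d"
        unfolding p'_def using less.prems q(1)
        by (intro mpoly.subspace_diff mpoly.subspace_scale subspace_graded_piece)
      have below: "k < m" if k: "k \<in> Poly_Mapping.keys p'" for k
      proof -
        have "k \<in> Poly_Mapping.keys p \<or> k \<in> Poly_Mapping.keys q"
          using k by (auto simp: p'_def in_keys_iff lookup_minus lookup_const_mult)
        then have "k \<le> m" using q(3) unfolding m_def by (metis Max_ge finite_keys)
        moreover have "Poly_Mapping.lookup p' m = 0"
          using q_key by (simp add: p'_def lookup_minus lookup_const_mult a_def in_keys_iff)
        ultimately show ?thesis using k by (metis in_keys_iff order.not_eq_order_implies_strict)
      qed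
      have "\<exists>s' \<in> ?S. p' - s' \<in> I"
      proof (cases "p' = 0")
        case True
        then show ?thesis using mpoly.subspace_0[OF I] mpoly.span_zero by force
      next
        case False
        then have "Max (Poly_Mapping.keys p') < m" using below Max_in[of "Poly_Mapping.keys p'"] by simp
        then have "{x \<in> Deg. x \<le> Max (Poly_Mapping.keys p')} \<subset> {x \<in> Deg. x \<le> m}"
          using m order.trans[OF _ less_imp_le, of _ "Max (Poly_Mapping.keys p')" m] leD by blast
        then have "card {x \<in> Deg. x \<le> Max (Poly_Mapping.keys p')} < card {x \<in> Deg. x \<le> Max (Poly_Mapping.keys p)}"
          unfolding m_def by (rule psubset_card_mono[rotated]) (use fin in simp)
        from less.hyps[OF this p'] show ?thesis .
      qed
      then obtain s' where s': "s' \<in> ?S" "p' - s' \<in> I" by blast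
      have "p - (s' + const a * s) = (p' - s') + const a * (q - s)"
        by (simp add: p'_def algebra_simps)
      also have "\<dots> \<in> I" using s s' by (intro mpoly.subspace_add[OF I] mpoly.subspace_scale[OF I])
      finally show ?thesis using s s'
        by (intro bexI[of _ "s' + const a * s"] mpoly.span_add mpoly.span_scale)
    qed
  qed
qed

lemma single_one_inj: "inj_on (\<lambda>m. Poly_Mapping.single m (1::'a::field)) A"
  by (rule inj_onI) (metis keys_single singleton_inject zero_neq_one)

lemma lookup_sum_singles:
  fixes c :: "'a::field mat_poly \<Rightarrow> 'a"
  assumes "finite M"
  shows "Poly_Mapping.lookup (\<Sum>b\<in>(\<lambda>m. Poly_Mapping.single m 1) ` M. const (c b) * b) m =
    (if m \<in> M then c (Poly_Mapping.single m 1) else 0)"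
  using assms
  by (simp add: sum.reindex[OF single_one_inj] lookup_sum lookup_const_mult lookup_single when_def if_distrib cong: if_cong)

text \<open>
  A nontrivial combination of standard monomials that lies in \<open>I\<close> would have a standard leading
  monomial.
\<close>

lemma standard_monomials_basis:
  fixes I :: "'a::field mat_poly set"
  assumes I: "mpoly.subspace I"
    and M: "M = {m \<in> monomials (index_set r n) - leading_monomials r n I. multidegree m = d}"
  shows "is_basis_mod (graded_piece r n d) I ((\<lambda>m. Poly_Mapping.single m 1) ` M)"
    (is "is_basis_mod ?V I ?B")
proof -
  have "M \<subseteq> {m. multidegree m = d}" by (auto simp: M)
  then have fin: "finite M" using finite_multidegree_fiber finite_subset by blast
  show ?thesis unfolding is_basis_mod_def
  proof (intro conjI ballI allI impI)
    fix p assume "p \<in> ?V"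
    then obtain s where s: "s \<in> mpoly.span ?B" "p - s \<in> I"
      using reduce_mod_ideal[OF I _ M] by blast
    then obtain c where "s = (\<Sum>b\<in>?B. const (c b) * b)"
      using mpoly.span_finite[of ?B] fin by auto
    with s show "\<exists>c. p - (\<Sum>b\<in>?B. const (c b) * b) \<in> I" by blast
  next
    fix c b assume c: "(\<Sum>b\<in>?B. const (c b) * b) \<in> I" and b: "b \<in> ?B"
    define q where "q = (\<Sum>b\<in>?B. const (c b) * b)"
    have lookup_q: "Poly_Mapping.lookup q m = (if m \<in> M then c (Poly_Mapping.single m 1) else 0)" for m
      unfolding q_def by (rule lookup_sum_singles[OF fin])
    then have keys: "Poly_Mapping.keys q \<subseteq> M" by (metis in_keys_iff subsetI)
    have "q = 0"
    proof (rule ccontr)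
      assume "q \<noteq> 0"
      moreover have "q \<in> ?V" using keys by (auto simp: keys_graded_piece M)
      ultimately have "Max (Poly_Mapping.keys q) \<in> leading_monomials r n I"
        using c unfolding leading_monomials_def q_def by blast
      moreover have "Max (Poly_Mapping.keys q) \<in> M"
        using keys \<open>q \<noteq> 0\<close> Max_in[of "Poly_Mapping.keys q"] by auto
      ultimately show False by (simp add: M)
    qed
    moreover obtain m where "m \<in> M" "b = Poly_Mapping.single m 1" using b by blast
    ultimately show "c b = 0" using lookup_q[of m] by simp
  qed (use fin in \<open>auto simp: keys_graded_piece M\<close>)
qed

section \<open>Evaluation and vanishing ideals\<close>

definition monomial_value :: "'a::comm_ring_1 mat \<Rightarrow> monomial \<Rightarrow> 'a" where
  "monomial_value A m = (\<Prod>x\<in>Poly_Mapping.keys m. (A $$ x) ^ Poly_Mapping.lookup m x)"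

lemma monomial_value_superset:
  assumes "finite K" "Poly_Mapping.keys m \<subseteq> K"
  shows "monomial_value A m = (\<Prod>x\<in>K. (A $$ x) ^ Poly_Mapping.lookup m x)"
  unfolding monomial_value_def
  by (rule prod.mono_neutral_left) (use assms in \<open>auto simp: in_keys_iff\<close>)

lemma monomial_value_zero [simp]: "monomial_value A 0 = 1"
  by (simp add: monomial_value_def)

lemma monomial_value_add: "monomial_value A (a + b) = monomial_value A a * monomial_value A b"
proof -
  define K where "K = Poly_Mapping.keys a \<union> Poly_Mapping.keys b"
  have "finite K" "Poly_Mapping.keys (a + b) \<subseteq> K" "Poly_Mapping.keys a \<subseteq> K" "Poly_Mapping.keys b \<subseteq> K"
    by (auto simp: K_def keys_add_nat)
  then show ?thesis
    by (simp add: monomial_value_superset[where K = K] lookup_add power_add prod.distrib)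
qed

lemma monomial_value_single [simp]: "monomial_value A (Poly_Mapping.single x k) = (A $$ x) ^ k"
  by (simp add: monomial_value_def)

lemma monomial_value_push:
  "monomial_value A (push f m) = (\<Prod>x\<in>Poly_Mapping.keys m. (A $$ f x) ^ Poly_Mapping.lookup m x)"
proof -
  have "monomial_value A (\<Sum>x\<in>K. Poly_Mapping.single (f x) (Poly_Mapping.lookup m x)) =
      (\<Prod>x\<in>K. (A $$ f x) ^ Poly_Mapping.lookup m x)" if "finite K" for K
    using that by (induction K rule: finite_induct) (simp_all add: monomial_value_add)
  then show ?thesis by (simp add: push_def)
qed

lemma eval_at_eq:
  "eval_at A p = (\<Sum>m\<in>Poly_Mapping.keys p. Poly_Mapping.lookup p m * monomial_value A m)"
  by (simp add: eval_at_def monomial_value_def)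

lemma eval_at_zero [simp]: "eval_at A 0 = 0"
  by (simp add: eval_at_eq)

lemma eval_at_single [simp]: "eval_at A (Poly_Mapping.single m c) = c * monomial_value A m"
  by (simp add: eval_at_eq)

lemma eval_at_add: "eval_at A (p + q) = eval_at A p + eval_at A q"
proof -
  define K where "K = Poly_Mapping.keys p \<union> Poly_Mapping.keys q"
  have superset: "eval_at A s = (\<Sum>m\<in>K. Poly_Mapping.lookup s m * monomial_value A m)"
    if "Poly_Mapping.keys s \<subseteq> K" for s
    unfolding eval_at_eq by (rule sum.mono_neutral_left) (use that in \<open>auto simp: in_keys_iff K_def\<close>)
  have "Poly_Mapping.keys (p + q) \<subseteq> K" "Poly_Mapping.keys p \<subseteq> K" "Poly_Mapping.keys q \<subseteq> K"
    using Poly_Mapping.keys_add[of p q] by (auto simp: K_def)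
  then show ?thesis by (simp add: superset lookup_add distrib_right sum.distrib)
qed

lemma eval_at_single_mult: "eval_at A (Poly_Mapping.single m c * p) = c * monomial_value A m * eval_at A p"
  by (induction p rule: poly_mapping_additive_induct)
     (simp_all add: distrib_left eval_at_add mult_single monomial_value_add)

lemma eval_at_push: "eval_at A (push f p) =
    (\<Sum>m\<in>Poly_Mapping.keys p. Poly_Mapping.lookup p m * monomial_value A (f m))"
proof -
  have "eval_at A (\<Sum>x\<in>K. Poly_Mapping.single (f x) (Poly_Mapping.lookup p x)) =
      (\<Sum>m\<in>K. Poly_Mapping.lookup p m * monomial_value A (f m))" if "finite K" for K
    using that by (induction K rule: finite_induct) (simp_all add: eval_at_add)
  then show ?thesis by (simp add: push_def)
qed

lemma subspace_vanishing_ideal: "mpoly.subspace (vanishing_ideal r n X)"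
proof (rule mpoly.subspaceI)
  fix p q assume "p \<in> vanishing_ideal r n X" "q \<in> vanishing_ideal r n X"
  then show "p + q \<in> vanishing_ideal r n X"
    by (simp add: vanishing_ideal_def eval_at_add mpoly.subspace_add[OF subspace_coordinate_ring])
next
  fix c p assume "p \<in> vanishing_ideal r n X"
  then show "const c * p \<in> vanishing_ideal r n X"
    using mpoly.subspace_scale[OF subspace_coordinate_ring, of p r n c]
    by (simp add: vanishing_ideal_def const_def eval_at_single_mult)
qed (simp add: vanishing_ideal_def mpoly.subspace_0[OF subspace_coordinate_ring])

lemma coordinate_ring_iff:
  "p \<in> coordinate_ring r n \<longleftrightarrow> Poly_Mapping.keys p \<subseteq> monomials (index_set r n)"
  unfolding coordinate_ring_def monomials_def by blast

lemma vanishing_ideal_monomial_mult: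
  assumes "p \<in> vanishing_ideal r n X" "m \<in> monomials (index_set r n)"
  shows "Poly_Mapping.single m 1 * p \<in> vanishing_ideal r n X"
proof -
  have "Poly_Mapping.keys (Poly_Mapping.single m 1 * p) \<subseteq> monomials (index_set r n)"
    using assms by (auto simp: keys_monomial_mult vanishing_ideal_def coordinate_ring_iff)
  then show ?thesis
    using assms(1) by (simp add: vanishing_ideal_def eval_at_single_mult coordinate_ring_iff)
qed

text \<open>
  The zero set of a single polynomial is closed, so a polynomial that vanishes on an orbit vanishes
  on the closure.
\<close>

lemma vanishing_ideal_orbit_closure:
  assumes "matrix_orbit r n v \<subseteq> carrier_mat r n"
  shows "vanishing_ideal r n (orbit_closure r n v) = vanishing_ideal r n (matrix_orbit r n v)"
proof (intro equalityI subsetI)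
  fix p assume "p \<in> vanishing_ideal r n (orbit_closure r n v)"
  then show "p \<in> vanishing_ideal r n (matrix_orbit r n v)"
    unfolding vanishing_ideal_def orbit_closure_def
    using hull_subset[of "matrix_orbit r n v" "zariski_closed r n"] by blast
next
  fix p assume p: "p \<in> vanishing_ideal r n (matrix_orbit r n v)"
  let ?Z = "{A \<in> carrier_mat r n. \<forall>q\<in>{p}. eval_at A q = 0}"
  have "zariski_closed r n ?Z"
    unfolding zariski_closed_def by (rule exI[of _ "{p}"]) (use p in \<open>simp add: vanishing_ideal_def\<close>)
  moreover have "matrix_orbit r n v \<subseteq> ?Z" using p assms by (auto simp: vanishing_ideal_def)
  ultimately have "orbit_closure r n v \<subseteq> ?Z"
    unfolding orbit_closure_def by (intro hull_minimal)
  with p show "p \<in> vanishing_ideal r n (orbit_closure r n v)" by (auto simp: vanishing_ideal_def)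
qed

lemma hilbert_function_standard:
  "hilbert_function r n X d = card {m \<in> monomials (index_set r n) -
    leading_monomials r n (vanishing_ideal r n X). multidegree m = d}"
  unfolding hilbert_function_def
  using quotient_dim_eqI[OF subspace_vanishing_ideal standard_monomials_basis[OF subspace_vanishing_ideal refl]]
  by (simp add: card_image single_one_inj)

lemma K_denominator_eq: "K_denominator r n = denominator (index_set r n)"
  by (simp add: K_denominator_def denominator_def prod.cartesian_product)

text \<open>
  By Dickson's lemma the leading monomials have finitely many minimal elements, and the Hilbert
  function counts the monomials that none of these divides.
\<close>

lemma K_polynomial_exists:
  "\<exists>P. poly_times_series (K_denominator r n) (\<lambda>e. int (hilbert_function r n X e)) = Poly_Mapping.lookup P"
proof -
  let ?M = "leading_monomials r n (vanishing_ideal r n X)"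
  obtain G where G: "finite G" "G \<subseteq> monomials (index_set r n)"
      "monomials (index_set r n) - ?M = standard_monomials (index_set r n) G"
    using up_set_standard_monomials[OF _ leading_monomials_subset
        leading_monomials_up_closed[OF vanishing_ideal_monomial_mult]]
    by (metis finite_SigmaI finite_lessThan)
  have "(\<lambda>e. int (hilbert_function r n X e)) = counting_series (standard_monomials (index_set r n) G)"
    by (simp add: hilbert_function_standard counting_series_def G(3) fun_eq_iff)
  then show ?thesis
    using denominator_times_standard_monomials[OF _ G(1,2)] by (simp add: K_denominator_eq)
qed

lemma K_polynomial_eqI:
  assumes "poly_times_series (K_denominator r n) (\<lambda>e. int (hilbert_function r n X e)) = Poly_Mapping.lookup P"
  shows "K_polynomial r n X = P"
  unfolding K_polynomial_def assms by (rule the_equality) (auto intro: poly_mapping_eqI)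

section \<open>Merging the last two columns\<close>

text \<open>
  Merging column \<open>Suc k\<close> into column \<open>k\<close>, on column indices, on matrix variables and on the
  variables of the grading.
\<close>

definition merge_col :: "nat \<Rightarrow> nat \<Rightarrow> nat" where
  "merge_col k j = (if j = Suc k then k else j)"

definition merge_var :: "nat \<Rightarrow> nat \<times> nat \<Rightarrow> nat \<times> nat" where
  "merge_var k = map_prod id (merge_col k)"

definition merge_gvar :: "nat \<Rightarrow> gvar \<Rightarrow> gvar" where
  "merge_gvar k g = (case g of U i \<Rightarrow> U i | T j \<Rightarrow> T (merge_col k j))"

lemma multidegree_merge: "multidegree (push (merge_var k) m) = push (merge_gvar k) (multidegree m)"
proof -
  have "U \<circ> fst \<circ> merge_var k = merge_gvar k \<circ> (U \<circ> fst)" "T \<circ> snd \<circ> merge_var k = merge_gvar k \<circ> (T \<circ> snd)"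
    by (auto simp: merge_gvar_def merge_var_def)
  then show ?thesis by (simp add: multidegree_push push_add push_push)
qed

text \<open>
  A degree \<open>(\<dots>, p, q)\<close> becomes \<open>(\<dots>, p + q, 0)\<close>.
\<close>

lemma lookup_merge_gvar:
  fixes d :: degree
  shows "Poly_Mapping.lookup (push (merge_gvar k) d) g =
    (if g = T (Suc k) then 0
     else if g = T k then Poly_Mapping.lookup d (T k) + Poly_Mapping.lookup d (T (Suc k))
     else Poly_Mapping.lookup d g)"
proof (induction d rule: poly_mapping_additive_induct)
  case (single x c)
  show ?case by (cases x) (auto simp: merge_gvar_def merge_col_def lookup_single when_def)
qed (simp_all add: push_add lookup_add)

lemma merge_monomials:
  assumes "m \<in> monomials (index_set r (Suc (Suc k)))"
  shows "push (merge_var k) m \<in> monomials (index_set r (Suc (Suc k)))"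
  using assms by (fastforce simp: monomials_def keys_push_nat merge_var_def merge_col_def)

lemma multidegree_T_nonzeroE:
  assumes "Poly_Mapping.lookup (multidegree m) (T j) \<noteq> 0"
  obtains x where "x \<in> Poly_Mapping.keys m" "snd x = j"
proof -
  have "\<exists>x\<in>Poly_Mapping.keys m. snd x = j"
  proof (rule ccontr)
    assume "\<not> (\<exists>x\<in>Poly_Mapping.keys m. snd x = j)"
    then have "Poly_Mapping.lookup (multidegree m) (T j) = 0"
      unfolding lookup_multidegree_T by (intro sum.neutral) auto
    with assms show False by simp
  qed
  with that show thesis by blast
qed

text \<open>
  The factors of \<open>m'\<close> from column \<open>k\<close> can be moved to column \<open>Suc k\<close> one at a time, until any
  prescribed number \<open>q\<close> of them has been moved.
\<close>

lemma merge_monomials_lift_partial: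
  assumes "push (merge_var k) m' = m'" "q \<le> Poly_Mapping.lookup (multidegree m') (T k)"
  shows "\<exists>m. push (merge_var k) m = m' \<and> Poly_Mapping.lookup (multidegree m) (T (Suc k)) = q"
  using assms(2)
proof (induction q)
  case 0
  have "Poly_Mapping.lookup (multidegree m') (T (Suc k)) = 0"
    using lookup_merge_gvar[of k "multidegree m'" "T (Suc k)"] multidegree_merge[of k m'] assms(1) by simp
  with assms(1) show ?case by blast
next
  case (Suc q)
  then obtain m where m: "push (merge_var k) m = m'" "Poly_Mapping.lookup (multidegree m) (T (Suc k)) = q"
    by auto
  have "Poly_Mapping.lookup (multidegree m') (T k) =
      Poly_Mapping.lookup (multidegree m) (T k) + Poly_Mapping.lookup (multidegree m) (T (Suc k))"
    using multidegree_merge[of k m] lookup_merge_gvar[of k "multidegree m" "T k"] m by simp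
  then have "Poly_Mapping.lookup (multidegree m) (T k) \<noteq> 0" using Suc.prems m by linarith
  then obtain x where x: "x \<in> Poly_Mapping.keys m" "snd x = k"
    by (rule multidegree_T_nonzeroE)
  define m0 where "m0 = m - Poly_Mapping.single x 1"
  have m_eq: "m = Poly_Mapping.single x 1 + m0"
    using x(1) by (intro poly_mapping_eqI)
      (auto simp: m0_def lookup_add lookup_minus lookup_single when_def in_keys_iff)
  define m1 where "m1 = Poly_Mapping.single (fst x, Suc k) 1 + m0"
  have "push (merge_var k) m1 = m'"
    unfolding m1_def m(1)[symmetric] m_eq using x(2)
    by (cases x) (simp add: push_add merge_var_def merge_col_def)
  moreover have "Poly_Mapping.lookup (multidegree m1) (T (Suc k)) = Suc q"
    using m(2) x(2) unfolding m1_def m_eq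
    by (simp add: multidegree_add lookup_add lookup_single when_def)
  ultimately show ?case by blast
qed

lemma merge_monomials_lift:
  assumes m': "m' \<in> monomials (index_set r (Suc (Suc k)))"
    and deg: "multidegree m' = push (merge_gvar k) d"
  shows "\<exists>m \<in> monomials (index_set r (Suc (Suc k))). multidegree m = d \<and> push (merge_var k) m = m'"
proof -
  have no_last: "Poly_Mapping.lookup (multidegree m') (T (Suc k)) = 0"
    by (simp add: deg lookup_merge_gvar)
  have "merge_var k x = x" if "x \<in> Poly_Mapping.keys m'" for x
  proof -
    have "snd x \<noteq> Suc k"
      using that lookup_le_multidegree_T[of m' x] no_last by (auto simp: in_keys_iff)
    then show ?thesis by (cases x) (simp add: merge_var_def merge_col_def)
  qed
  then have "push (merge_var k) m' = m'" using push_cong[of m' "merge_var k" "\<lambda>x. x"] by simp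
  moreover have "Poly_Mapping.lookup d (T (Suc k)) \<le> Poly_Mapping.lookup (multidegree m') (T k)"
    by (simp add: deg lookup_merge_gvar)
  ultimately obtain m where m: "push (merge_var k) m = m'"
      "Poly_Mapping.lookup (multidegree m) (T (Suc k)) = Poly_Mapping.lookup d (T (Suc k))"
    using merge_monomials_lift_partial by blast
  have "multidegree m = d"
  proof (rule poly_mapping_eqI)
    fix g
    have "push (merge_gvar k) (multidegree m) = push (merge_gvar k) d"
      using m(1) deg multidegree_merge[of k m] by simp
    then have "Poly_Mapping.lookup (push (merge_gvar k) (multidegree m)) g = Poly_Mapping.lookup (push (merge_gvar k) d) g"
      by simp
    then show "Poly_Mapping.lookup (multidegree m) g = Poly_Mapping.lookup d g"
      using m(2) by (auto simp: lookup_merge_gvar split: if_splits)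
  qed
  moreover have "m \<in> monomials (index_set r (Suc (Suc k)))"
    unfolding monomials_def mem_Collect_eq
  proof
    fix x assume "x \<in> Poly_Mapping.keys m"
    then have "merge_var k x \<in> Poly_Mapping.keys m'" by (simp add: m(1)[symmetric] keys_push_nat)
    then have "merge_var k x \<in> index_set r (Suc (Suc k))" using m' by (auto simp: monomials_def)
    then show "x \<in> index_set r (Suc (Suc k))"
      by (cases x) (auto simp: merge_var_def merge_col_def split: if_splits)
  qed
  ultimately show ?thesis using m(1) by blast
qed

text \<open>
  Surjectivity holds because the factors of a monomial from column \<open>k\<close> can be distributed over the
  two columns as the degree \<open>d\<close> prescribes.
\<close>

lemma merge_graded_piece:
  "push (push (merge_var k)) ` graded_piece r (Suc (Suc k)) d =
    (graded_piece r (Suc (Suc k)) (push (merge_gvar k) d) :: 'a::field mat_poly set)"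
proof (intro equalityI subsetI)
  fix p :: "'a mat_poly" assume "p \<in> push (push (merge_var k)) ` graded_piece r (Suc (Suc k)) d"
  then obtain q where q: "q \<in> graded_piece r (Suc (Suc k)) d" "p = push (push (merge_var k)) q" by blast
  have "push (merge_var k) m \<in> {m \<in> monomials (index_set r (Suc (Suc k))). multidegree m = push (merge_gvar k) d}"
    if "m \<in> Poly_Mapping.keys q" for m
    using that q(1) merge_monomials by (auto simp: keys_graded_piece multidegree_merge)
  then show "p \<in> graded_piece r (Suc (Suc k)) (push (merge_gvar k) d)"
    unfolding keys_graded_piece q(2) using keys_push_subset[of "push (merge_var k)" q] by blast
next
  fix p :: "'a mat_poly" assume p: "p \<in> graded_piece r (Suc (Suc k)) (push (merge_gvar k) d)"
  have "\<forall>m'\<in>Poly_Mapping.keys p. \<exists>m. m \<in> monomials (index_set r (Suc (Suc k))) \<and>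
      multidegree m = d \<and> push (merge_var k) m = m'"
  proof
    fix m' assume "m' \<in> Poly_Mapping.keys p"
    then show "\<exists>m. m \<in> monomials (index_set r (Suc (Suc k))) \<and> multidegree m = d \<and> push (merge_var k) m = m'"
      using merge_monomials_lift[of m' r k d] p by (auto simp: keys_graded_piece)
  qed
  from bchoice[OF this] obtain h where h: "\<forall>m'\<in>Poly_Mapping.keys p. h m' \<in> monomials (index_set r (Suc (Suc k))) \<and>
      multidegree (h m') = d \<and> push (merge_var k) (h m') = m'" by (rule exE)
  have "push (push (merge_var k)) (push h p) = p"
    using h push_cong[of p "push (merge_var k) \<circ> h" "\<lambda>m. m"] by (simp add: push_push)
  moreover have "push h p \<in> graded_piece r (Suc (Suc k)) d"
    unfolding keys_graded_piece using keys_push_subset[of h p] h by blast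
  ultimately show "p \<in> push (push (merge_var k)) ` graded_piece r (Suc (Suc k)) d"
    by (metis imageI)
qed

lemma monomial_value_merge:
  fixes A W :: "'a::field mat"
  assumes W: "\<And>i j. i < r \<Longrightarrow> j < Suc (Suc k) \<Longrightarrow>
      W $$ (i, j) = (if j = Suc k then c else 1) * A $$ (i, merge_col k j)"
    and m: "m \<in> monomials (index_set r (Suc (Suc k)))"
  shows "monomial_value W m = c ^ Poly_Mapping.lookup (multidegree m) (T (Suc k)) *
    monomial_value A (push (merge_var k) m)"
proof -
  have "monomial_value W m = (\<Prod>x\<in>Poly_Mapping.keys m.
      (c ^ (Poly_Mapping.lookup m x when snd x = Suc k)) * (A $$ merge_var k x) ^ Poly_Mapping.lookup m x)"
    unfolding monomial_value_def
  proof (rule prod.cong)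
    fix x assume x: "x \<in> Poly_Mapping.keys m"
    obtain i j where ij: "x = (i, j)" by (cases x)
    have "i < r" "j < Suc (Suc k)" using x m ij by (auto simp: monomials_def)
    then show "(W $$ x) ^ Poly_Mapping.lookup m x =
        (c ^ (Poly_Mapping.lookup m x when snd x = Suc k)) * (A $$ merge_var k x) ^ Poly_Mapping.lookup m x"
      by (simp add: ij W merge_var_def power_mult_distrib)
  qed simp
  then show ?thesis
    by (simp add: prod.distrib power_sum monomial_value_push lookup_multidegree_T)
qed

text \<open>
  If the last column of \<open>W\<close> is \<open>c\<close> times column \<open>k\<close> of \<open>A\<close>, and the other columns agree, then each
  factor from the last column contributes one \<open>c\<close>, so the value depends on the degree of \<open>p\<close> and on
  the substituted polynomial alone.
\<close>

lemma eval_at_merge: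
  fixes A W :: "'a::field mat"
  assumes W: "\<And>i j. i < r \<Longrightarrow> j < Suc (Suc k) \<Longrightarrow>
      W $$ (i, j) = (if j = Suc k then c else 1) * A $$ (i, merge_col k j)"
    and p: "p \<in> graded_piece r (Suc (Suc k)) d"
  shows "eval_at W p = c ^ Poly_Mapping.lookup d (T (Suc k)) * eval_at A (push (push (merge_var k)) p)"
proof -
  have "eval_at W p = (\<Sum>m\<in>Poly_Mapping.keys p. Poly_Mapping.lookup p m *
      (c ^ Poly_Mapping.lookup d (T (Suc k)) * monomial_value A (push (merge_var k) m)))"
    unfolding eval_at_eq
  proof (rule sum.cong)
    fix m assume "m \<in> Poly_Mapping.keys p"
    then have "m \<in> monomials (index_set r (Suc (Suc k)))" "multidegree m = d"
      using p by (auto simp: keys_graded_piece)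
    then show "Poly_Mapping.lookup p m * monomial_value W m = Poly_Mapping.lookup p m *
      (c ^ Poly_Mapping.lookup d (T (Suc k)) * monomial_value A (push (merge_var k) m))"
      using monomial_value_merge[OF W] by metis
  qed simp
  then show ?thesis by (simp add: eval_at_push sum_distrib_left algebra_simps)
qed

lemma orbit_point_entry:
  assumes "g \<in> carrier_mat r r" "v \<in> carrier_mat r n" "i < r" "j < n"
  shows "(g * v * mat_diag n s) $$ (i, j) = (row g i \<bullet> col v j) * s j"
  using assms by (simp add: mat_diag_mult_right[of "g * v" r n])

lemma matrix_orbit_carrier:
  assumes "v \<in> carrier_mat r n"
  shows "matrix_orbit r n v \<subseteq> carrier_mat r n"
proof
  fix A assume "A \<in> matrix_orbit r n v"
  then obtain g s where "A = g * v * mat_diag n s" "g \<in> carrier_mat r r"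
    unfolding matrix_orbit_def by blast
  with assms show "A \<in> carrier_mat r n" by (metis mat_diag_dim mult_carrier_mat)
qed

text \<open>
  The last two columns have the indices \<open>k\<close> and \<open>Suc k\<close>, which avoids subtraction on indices.
\<close>

locale parallel_columns =
  fixes r k :: nat and v w :: "'a::field mat"
  assumes w: "w \<in> carrier_mat r (Suc (Suc k))"
    and v: "v \<in> carrier_mat r (Suc (Suc k))"
    and parallel: "col w k = col w (Suc k)"
    and v_cols: "\<And>j. j < Suc k \<Longrightarrow> col v j = col w j"
    and v_last: "col v (Suc k) = 0\<^sub>v r"
begin

abbreviation "n \<equiv> Suc (Suc k)"

lemma orbit_points:
  assumes g: "g \<in> carrier_mat r r" and s: "\<And>j. j < n \<Longrightarrow> s j \<noteq> 0" and "i < r" "j < n"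
  shows "(g * w * mat_diag n s) $$ (i, j) = (if j = Suc k then s (Suc k) / s k else 1) *
    (g * v * mat_diag n s) $$ (i, merge_col k j)"
proof -
  have "merge_col k j < n" using assms(4) by (auto simp: merge_col_def)
  moreover have "s k \<noteq> 0" using s by simp
  moreover have "j = Suc k \<or> j < Suc k" using assms(4) by linarith
  ultimately show ?thesis
    using assms(3,4) v_cols[of k] v_cols[of j] parallel
    by (auto simp: orbit_point_entry[OF g w] orbit_point_entry[OF g v] merge_col_def)
qed

text \<open>
  The matrices \<open>g w diag(s)\<close> and \<open>g v diag(s)\<close> run through the two orbits together, and the values
  at them differ by a power of \<open>s (Suc k) / s k\<close>, which is nonzero.
\<close>

lemma vanishing_iff:
  assumes p: "p \<in> graded_piece r n d"
  shows "p \<in> vanishing_ideal r n (matrix_orbit r n w) \<longleftrightarrow>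
    push (push (merge_var k)) p \<in> vanishing_ideal r n (matrix_orbit r n v)"
proof -
  have eval: "eval_at (g * w * mat_diag n s) p =
      (s (Suc k) / s k) ^ Poly_Mapping.lookup d (T (Suc k)) *
      eval_at (g * v * mat_diag n s) (push (push (merge_var k)) p)"
    if "g \<in> carrier_mat r r" "\<forall>j<n. s j \<noteq> 0" for g s
    by (rule eval_at_merge[OF _ p]) (use that in \<open>intro orbit_points, auto\<close>)
  have factor: "(s (Suc k) / s k) ^ q \<noteq> 0" if "\<forall>j<n. s j \<noteq> 0" for s :: "nat \<Rightarrow> 'a" and q :: nat
    using that by simp
  have "p \<in> coordinate_ring r n" using p by (simp add: graded_piece_def)
  moreover have "push (push (merge_var k)) p \<in> graded_piece r n (push (merge_gvar k) d)"
    using p merge_graded_piece[of k r d] by blast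
  then have "push (push (merge_var k)) p \<in> coordinate_ring r n" by (simp add: graded_piece_def)
  moreover have "(\<forall>A\<in>matrix_orbit r n w. eval_at A p = 0) \<longleftrightarrow>
      (\<forall>A\<in>matrix_orbit r n v. eval_at A (push (push (merge_var k)) p) = 0)"
  proof (intro iffI ballI)
    fix A assume *: "\<forall>A\<in>matrix_orbit r n w. eval_at A p = 0" and "A \<in> matrix_orbit r n v"
    then obtain g s where A: "A = g * v * mat_diag n s"
      and gs: "g \<in> carrier_mat r r" "invertible_mat g" "\<forall>j<n. s j \<noteq> 0"
      unfolding matrix_orbit_def by blast
    have "g * w * mat_diag n s \<in> matrix_orbit r n w" using gs unfolding matrix_orbit_def by blast
    with * eval[OF gs(1,3)] have "(s (Suc k) / s k) ^ Poly_Mapping.lookup d (T (Suc k)) *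
        eval_at (g * v * mat_diag n s) (push (push (merge_var k)) p) = 0" by metis
    then show "eval_at A (push (push (merge_var k)) p) = 0"
      using factor[OF gs(3)] unfolding A mult_eq_0_iff by blast
  next
    fix A assume *: "\<forall>A\<in>matrix_orbit r n v. eval_at A (push (push (merge_var k)) p) = 0"
      and "A \<in> matrix_orbit r n w"
    then obtain g s where A: "A = g * w * mat_diag n s"
      and gs: "g \<in> carrier_mat r r" "invertible_mat g" "\<forall>j<n. s j \<noteq> 0"
      unfolding matrix_orbit_def by blast
    have "g * v * mat_diag n s \<in> matrix_orbit r n v" using gs unfolding matrix_orbit_def by blast
    then show "eval_at A p = 0" using * eval[OF gs(1,3)] A by simp
  qed
  ultimately show ?thesis by (simp add: vanishing_ideal_def)
qed

lemma hilbert_function_parallel: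
  "hilbert_function r n (orbit_closure r n w) d =
    hilbert_function r n (orbit_closure r n v) (push (merge_gvar k) d)"
  unfolding hilbert_function_def
    vanishing_ideal_orbit_closure[OF matrix_orbit_carrier[OF w]]
    vanishing_ideal_orbit_closure[OF matrix_orbit_carrier[OF v]]
  by (rule quotient_dim_transfer[where \<phi> = "push (push (merge_var k))",
        OF subspace_vanishing_ideal subspace_vanishing_ideal subspace_graded_piece push_add
          push_const_mult merge_graded_piece vanishing_iff
          standard_monomials_basis[OF subspace_vanishing_ideal refl]])

text \<open>
  A monomial of positive degree in the last column vanishes wherever that column is zero.
\<close>

lemma hilbert_function_last_zero:
  assumes "Poly_Mapping.lookup d (T (Suc k)) > 0"
  shows "hilbert_function r n (orbit_closure r n v) d = 0"
  unfolding hilbert_function_def vanishing_ideal_orbit_closure[OF matrix_orbit_carrier[OF v]]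
proof (rule quotient_dim_eq_0[OF subspace_vanishing_ideal], rule subsetI)
  fix p :: "'a mat_poly" assume p: "p \<in> graded_piece r n d"
  have "eval_at A p = 0" if A: "A \<in> matrix_orbit r n v" for A
  proof -
    obtain g s where A: "A = g * v * mat_diag n s" and g: "g \<in> carrier_mat r r"
      using A unfolding matrix_orbit_def by blast
    have "monomial_value A m = 0" if m: "m \<in> Poly_Mapping.keys p" for m
    proof -
      have m': "m \<in> monomials (index_set r n)" "multidegree m = d"
        using p m by (auto simp: keys_graded_piece)
      then have "Poly_Mapping.lookup (multidegree m) (T (Suc k)) \<noteq> 0" using assms by simp
      then obtain x where x: "x \<in> Poly_Mapping.keys m" "snd x = Suc k"
        by (rule multidegree_T_nonzeroE)
      obtain i where "x = (i, Suc k)" "i < r" using x m'(1) by (cases x) (auto simp: monomials_def)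
      then have "A $$ x = 0"
        unfolding A using orbit_point_entry[OF g v, of i "Suc k" s] g v_last by simp
      then show ?thesis
        unfolding monomial_value_def using x(1)
        by (intro prod_zero) (auto simp: in_keys_iff intro!: bexI[of _ x])
    qed
    then show ?thesis by (simp add: eval_at_eq)
  qed
  then show "p \<in> vanishing_ideal r n (matrix_orbit r n v)"
    using p by (simp add: vanishing_ideal_def graded_piece_def)
qed

end

section \<open>Exchanging the last two column variables\<close>

definition swap_gvar :: "nat \<Rightarrow> gvar \<Rightarrow> gvar" where
  "swap_gvar k = transpose (T k) (T (Suc k))"

lemma swap_gvar_involution [simp]: "swap_gvar k (swap_gvar k g) = g"
  by (simp add: swap_gvar_def)

lemma push_swap_involution: "push (swap_gvar k) (push (swap_gvar k) d) = d"
  by (rule poly_mapping_eqI) (simp add: lookup_push_involution)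

lemma swap_T_push: "swap_T k f = push (push (swap_gvar k)) f"
proof -
  have map: "Poly_Mapping.map_key (swap_gvar k) = (push (swap_gvar k) :: degree \<Rightarrow> degree)"
  proof (rule ext)
    fix d :: degree
    have "inj (swap_gvar k)" by (metis injI swap_gvar_involution)
    then show "Poly_Mapping.map_key (swap_gvar k) d = push (swap_gvar k) d"
      by (intro poly_mapping_eqI) (simp add: map_key.rep_eq lookup_push_involution)
  qed
  have inj: "inj (push (swap_gvar k) :: degree \<Rightarrow> degree)" by (metis injI push_swap_involution)
  show ?thesis
    unfolding swap_T_def swap_gvar_def[symmetric] map
    by (rule poly_mapping_eqI) (simp add: map_key.rep_eq[OF inj] lookup_push_involution push_swap_involution)
qed

lemma push_diff:
  fixes p q :: "'x \<Rightarrow>\<^sub>0 'b::ab_group_add"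
  shows "push f (p - q) = push f p - push f q"
  using push_add[of f "p - q" q] by (simp add: algebra_simps)

lemma push_prod:
  fixes g :: "'i \<Rightarrow> ('k::cancel_comm_monoid_add \<Rightarrow>\<^sub>0 'b::comm_semiring_1)"
    and f :: "'k \<Rightarrow> 'l::cancel_comm_monoid_add"
  assumes "\<And>x y. f (x + y) = f x + f y"
  shows "push f (prod g A) = (\<Prod>x\<in>A. push f (g x))"
proof -
  have "f 0 = 0" using assms[of 0 0] by (metis add_cancel_right_right add_0)
  then have "push f 1 = (1 :: 'l \<Rightarrow>\<^sub>0 'b)"
    using push_single[of f 0 "1 :: 'b"] by simp
  then show ?thesis
    by (induction A rule: infinite_finite_induct) (simp_all add: push_mult[OF assms])
qed

text \<open>
  The factors \<open>1 - u\<^sub>i t\<^sub>j\<close> of the denominator are permuted.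
\<close>

lemma swap_denominator:
  "push (push (swap_gvar k)) (denominator (index_set r (Suc (Suc k)))) = denominator (index_set r (Suc (Suc k)))"
proof -
  define h where "h = map_prod (id :: nat \<Rightarrow> nat) (transpose k (Suc k))"
  have h_inv: "h (h x) = x" for x by (cases x) (simp add: h_def)
  have h_index: "h x \<in> index_set r (Suc (Suc k))" if "x \<in> index_set r (Suc (Suc k))" for x
    using that by (cases x) (auto simp: h_def transpose_def)
  have "push (push (swap_gvar k)) (1 - Poly_Mapping.single (var_degree x) 1) =
      (1 - Poly_Mapping.single (var_degree (h x)) 1 :: ut_poly)" for x
  proof -
    have "push (swap_gvar k) (var_degree x) = var_degree (h x)"
      by (cases x) (simp add: var_degree_def push_add swap_gvar_def h_def transpose_def)
    moreover have "push (push (swap_gvar k)) 1 = (1 :: ut_poly)"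
      using push_single[of "push (swap_gvar k)" 0 "1 :: int"] by simp
    ultimately show ?thesis by (simp add: push_diff)
  qed
  then have "push (push (swap_gvar k)) (denominator (index_set r (Suc (Suc k)))) =
      (\<Prod>x\<in>index_set r (Suc (Suc k)). 1 - Poly_Mapping.single (var_degree (h x)) 1)"
    unfolding denominator_def denominator_factor by (simp add: push_prod push_add)
  also have "\<dots> = (\<Prod>x\<in>index_set r (Suc (Suc k)). 1 - Poly_Mapping.single (var_degree x) 1)"
    by (rule prod.reindex_bij_witness[of _ h h]) (use h_inv h_index in auto)
  finally show ?thesis unfolding denominator_def denominator_factor .
qed

section \<open>The divided difference\<close>

lemma shift_single:
  "shift (Poly_Mapping.single x 1) H d =
    (if Poly_Mapping.lookup d x > 0 then H (d - Poly_Mapping.single x 1) else 0)"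
proof -
  have "d = Poly_Mapping.single x 1 + (d - Poly_Mapping.single x 1)" if "Poly_Mapping.lookup d x > 0"
    using that by (intro poly_mapping_eqI) (auto simp: lookup_add lookup_minus lookup_single when_def)
  then have "(\<exists>e. d = Poly_Mapping.single x 1 + e) \<longleftrightarrow> Poly_Mapping.lookup d x > 0"
    by (auto simp: lookup_add)
  then show ?thesis by (simp add: shift_def)
qed

text \<open>
  Injectivity of multiplication by \<open>x - y\<close> on power series.  Comparing coefficients trades a factor
  \<open>y\<close> for a factor \<open>x\<close> without changing the coefficient; once no \<open>y\<close> is left, the coefficient is
  zero.
\<close>

lemma shift_eq_imp_zero:
  assumes "x \<noteq> y" and eq: "\<And>d. shift (Poly_Mapping.single x 1) H d = shift (Poly_Mapping.single y 1) H d"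
  shows "H d = 0"
proof (induction "Poly_Mapping.lookup d y" arbitrary: d)
  case 0
  have "H d = shift (Poly_Mapping.single y 1) H (Poly_Mapping.single x 1 + d)"
    using eq[of "Poly_Mapping.single x 1 + d"] by simp
  also have "\<dots> = 0" using 0 assms(1) by (simp add: shift_single lookup_add lookup_single when_def del: One_nat_def)
  finally show ?case .
next
  case (Suc b)
  define d' where "d' = Poly_Mapping.single x 1 + d - Poly_Mapping.single y 1"
  have "H d = shift (Poly_Mapping.single y 1) H (Poly_Mapping.single x 1 + d)"
    using eq[of "Poly_Mapping.single x 1 + d"] by simp
  also have "\<dots> = H d'"
    using Suc.hyps(2) by (simp add: shift_single lookup_add d'_def del: One_nat_def)
  also have "\<dots> = 0"
    using Suc.hyps(2) assms(1)
    by (intro Suc.hyps(1)) (simp add: d'_def lookup_add lookup_minus lookup_single when_def)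
  finally show ?case .
qed

lemma poly_times_series_var: "poly_times_series (var x) H d = shift (Poly_Mapping.single x 1) H d"
  by (simp add: var_def)

lemma delta_eqI:
  assumes "(var (T k) - var (T (Suc k))) * g = var (T k) * f - var (T (Suc k)) * swap_T k f"
  shows "delta k f = g"
  unfolding delta_def
proof (rule the_equality)
  show "(var (T k) - var (T (Suc k))) * g = var (T k) * f - var (T (Suc k)) * swap_T k f" by (rule assms)
next
  fix g' assume "(var (T k) - var (T (Suc k))) * g' = var (T k) * f - var (T (Suc k)) * swap_T k f"
  with assms have "(var (T k) - var (T (Suc k))) * (g' - g) = 0" by (simp add: right_diff_distrib)
  then have "poly_times_series (var (T k) - var (T (Suc k))) (Poly_Mapping.lookup (g' - g)) d = 0" for d
    by (simp add: poly_times_series_lookup)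
  then have "Poly_Mapping.lookup (g' - g) d = 0" for d
    by (intro shift_eq_imp_zero[of "T k" "T (Suc k)"]) (simp_all add: poly_times_series_diff poly_times_series_var)
  then have "g' - g = 0" by (intro poly_mapping_eqI) simp
  then show "g' = g" by simp
qed

context parallel_columns
begin

text \<open>
  With \<open>p\<close> and \<open>q\<close> the exponents of the last two column variables in \<open>d\<close>, the left-hand side
  involves \<open>H\<^sub>w\<close> at \<open>(p - 1, q)\<close> and at \<open>(p, q - 1)\<close>.  If both are positive these terms cancel,
  and the right-hand side vanishes because \<open>H\<^sub>v\<close> is supported on exponents with \<open>q = 0\<close>.  If just one
  is positive, one term survives on each side and the two agree.
\<close>

lemma hilbert_series_divided_difference:
  fixes H_v H_w
  defines "H_v \<equiv> \<lambda>e. int (hilbert_function r n (orbit_closure r n v) e)"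
    and "H_w \<equiv> \<lambda>e. int (hilbert_function r n (orbit_closure r n w) e)"
  shows "poly_times_series (var (T k) - var (T (Suc k))) H_w d =
    poly_times_series (var (T k)) H_v d -
    poly_times_series (var (T (Suc k))) (\<lambda>e. H_v (push (swap_gvar k) e)) d"
proof -
  define p where "p = Poly_Mapping.lookup d (T k)"
  define q where "q = Poly_Mapping.lookup d (T (Suc k))"
  have H_w: "H_w e = H_v (push (merge_gvar k) e)" for e
    by (simp add: H_w_def H_v_def hilbert_function_parallel)
  have H_v: "H_v e = 0" if "Poly_Mapping.lookup e (T (Suc k)) > 0" for e
    using hilbert_function_last_zero[OF that] by (simp add: H_v_def)
  have swap: "Poly_Mapping.lookup (push (swap_gvar k) e) g = (if g = T k then Poly_Mapping.lookup e (T (Suc k))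
      else if g = T (Suc k) then Poly_Mapping.lookup e (T k) else Poly_Mapping.lookup e g)" for e :: degree and g
    by (simp add: lookup_push_involution swap_gvar_def transpose_def)
  let ?t = "Poly_Mapping.single (T k) 1 :: degree" and ?s = "Poly_Mapping.single (T (Suc k)) 1 :: degree"
  have both: "push (merge_gvar k) (d - ?t) = push (merge_gvar k) (d - ?s)" if "p > 0" "q > 0"
    using that by (intro poly_mapping_eqI)
      (auto simp: lookup_merge_gvar lookup_minus lookup_single when_def p_def q_def)
  have only_t: "push (merge_gvar k) (d - ?t) = d - ?t" if "q = 0"
    using that by (intro poly_mapping_eqI)
      (auto simp: lookup_merge_gvar lookup_minus lookup_single when_def q_def)
  have only_s: "push (merge_gvar k) (d - ?s) = push (swap_gvar k) (d - ?s)" if "p = 0"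
    using that by (intro poly_mapping_eqI)
      (auto simp: lookup_merge_gvar swap lookup_minus lookup_single when_def p_def)
  have vanish_t: "H_v (d - ?t) = 0" if "q > 0"
    using that by (intro H_v) (simp add: lookup_minus lookup_single when_def q_def)
  have vanish_s: "H_v (push (swap_gvar k) (d - ?s)) = 0" if "p > 0"
    using that by (intro H_v) (simp add: swap lookup_minus lookup_single when_def p_def)
  show ?thesis
    unfolding poly_times_series_diff poly_times_series_var shift_single H_w p_def[symmetric] q_def[symmetric]
    using both only_t only_s vanish_t vanish_s by (cases "p > 0"; cases "q > 0") auto
qed

text \<open>
  Multiplying the equation of Hilbert series by the denominator, which commutes with the exchange
  of the two variables, gives the defining equation of the divided difference.
\<close>

lemma K_polynomial_parallel:
  "K_polynomial r n (orbit_closure r n w) = delta k (K_polynomial r n (orbit_closure r n v))"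
proof -
  define H_v where "H_v = (\<lambda>e. int (hilbert_function r n (orbit_closure r n v) e))"
  define H_w where "H_w = (\<lambda>e. int (hilbert_function r n (orbit_closure r n w) e))"
  define D where "D = K_denominator r n"
  define t s :: ut_poly where "t = var (T k)" and "s = var (T (Suc k))"
  define K_v where "K_v = K_polynomial r n (orbit_closure r n v)"
  define K_w where "K_w = K_polynomial r n (orbit_closure r n w)"
  have K: "poly_times_series D H_v = Poly_Mapping.lookup K_v" "poly_times_series D H_w = Poly_Mapping.lookup K_w"
    unfolding D_def H_v_def H_w_def K_v_def K_w_def
    using K_polynomial_exists[of r n] K_polynomial_eqI[of r n] by metis+
  have swap: "poly_times_series D (\<lambda>e. H_v (push (swap_gvar k) e)) = Poly_Mapping.lookup (swap_T k K_v)"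
  proof
    fix d
    have "poly_times_series D (\<lambda>e. H_v (push (swap_gvar k) e)) d =
        poly_times_series (push (push (swap_gvar k)) D) (\<lambda>e. H_v (push (swap_gvar k) e)) d"
      by (simp add: D_def K_denominator_eq swap_denominator)
    also have "\<dots> = poly_times_series D H_v (push (swap_gvar k) d)"
      by (rule poly_times_series_push) (simp_all add: push_swap_involution push_add)
    also have "\<dots> = Poly_Mapping.lookup (swap_T k K_v) d"
      by (simp add: K swap_T_push lookup_push_involution push_swap_involution)
    finally show "poly_times_series D (\<lambda>e. H_v (push (swap_gvar k) e)) d = Poly_Mapping.lookup (swap_T k K_v) d" .
  qed
  have commute: "poly_times_series D (poly_times_series P H) = poly_times_series P (poly_times_series D H)" for P H
    by (rule ext) (metis mult.commute poly_times_series_mult)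
  have "(t - s) * K_w = t * K_v - s * swap_T k K_v"
  proof (rule poly_mapping_eqI)
    fix d
    have "Poly_Mapping.lookup ((t - s) * K_w) d = poly_times_series D (poly_times_series (t - s) H_w) d"
      by (simp add: commute K poly_times_series_lookup)
    also have "poly_times_series (t - s) H_w = (\<lambda>d. 1 * poly_times_series t H_v d +
        (- 1) * poly_times_series s (\<lambda>e. H_v (push (swap_gvar k) e)) d)"
      by (rule ext) (simp add: hilbert_series_divided_difference t_def s_def H_v_def H_w_def)
    also have "poly_times_series D \<dots> d = poly_times_series D (poly_times_series t H_v) d -
        poly_times_series D (poly_times_series s (\<lambda>e. H_v (push (swap_gvar k) e))) d"
      by (subst poly_times_series_linear) simp
    also have "\<dots> = Poly_Mapping.lookup (t * K_v - s * swap_T k K_v) d"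
      by (simp add: commute K swap poly_times_series_lookup lookup_minus)
    finally show "Poly_Mapping.lookup ((t - s) * K_w) d = Poly_Mapping.lookup (t * K_v - s * swap_T k K_v) d" .
  qed
  then show ?thesis by (simp add: delta_eqI t_def s_def K_v_def K_w_def)
qed

end

theorem theorem7p3:
  fixes r n :: nat
    and v w :: "'a::{alg_closed_field, field_char_0} mat"
  assumes "n \<ge> 2"
    and "w \<in> carrier_mat r n"
    and "col w (n - 2) = col w (n - 1)"
    and "col w (n - 1) \<noteq> 0\<^sub>v r"
    and "v \<in> carrier_mat r n"
    and "\<And>j. j < n - 1 \<Longrightarrow> col v j = col w j"
    and "col v (n - 1) = 0\<^sub>v r"
  shows "K_polynomial r n (orbit_closure r n w) = delta (n - 2) (K_polynomial r n (orbit_closure r n v))"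
proof -
  obtain k where n: "n = Suc (Suc k)" using assms(1) by (metis add_2_eq_Suc le_Suc_ex)
  interpret parallel_columns r k v w
    using assms by unfold_locales (simp_all add: n)
  show ?thesis using K_polynomial_parallel by (simp add: n)
qed

end
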